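(* Let $X$ be an order continuous Banach lattice. Then every relatively weakly compact uo-Cauchy net $(x_\alpha)$ in $X$ converges uo- and in $|\sigma|(X,X^* )$ to the same limit; that is, there is $x\in X$ such that $x_\alpha\xrightarrow{uo}x$ and $x^*(|x_\alpha-x|)\to 0$ for every $x^*\in X^*_+$.
   Context: A Banach lattice is order continuous if every order null net is norm null. A net is called relatively weakly compact if the set of its members is relatively weakly compact. A net $(x_\alpha)$ in a vector lattice $X$ order converges to $x$ ($x_\alpha\xrightarrow{o}x$) if there is a net $(z_\beta)$ (possibly over a different index set) with $z_\beta\downarrow 0$ such that for every $\beta$ there is $\alpha_0$ with $|x_\alpha-x|\le z_\beta$ for all $\alpha\ge\alpha_0$. The net uo-converges to $x$ ($x_\alpha\xrightarrow{uo}x$) if $|x_\alpha-x|\wedge y\xrightarrow{o}0$ for all $y\in X_+$. A net $(x_\alpha)_{\alpha\in\Gamma}$ is uo-Cauchy if the net $(x_\alpha-x_{\alpha'})_{(\alpha,\alpha')\in\Gamma\times\Gamma}$ uo-converges to $0$. $|\sigma|(X,X^* )$ is the absolute weak topology on $X$, generated by the seminorms $x\mapsto x^*(|x|)$, $x^*\in X^*_+$, where $X^*$ is the norm dual. *)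

theory Defs
  imports "HOL-Analysis.Analysis" "HOL-Library.Lattice_Algebras"
begin

class vector_lattice = ordered_real_vector + lattice_ab_group_add_abs

class banach_lattice = banach + vector_lattice +
  assumes norm_mono_abs: "\<bar>x\<bar> \<le> \<bar>y\<bar> \<Longrightarrow> norm x \<le> norm y"

instance real :: banach_lattice
  by standard simp


text \<open>A net is a function on the carrier \<open>A\<close> of a nonempty directed preorder \<open>r\<close>, where
  \<open>(a, b) \<in> r\<close> means that \<open>b\<close> is beyond \<open>a\<close>. Values outside \<open>A\<close> are irrelevant.\<close>

definition directed_set :: "'i set \<Rightarrow> 'i rel \<Rightarrow> bool" where
  "directed_set A r \<longleftrightarrow>
     A \<noteq> {} \<and> preorder_on A r \<and> (\<forall>a\<in>A. \<forall>b\<in>A. \<exists>c\<in>A. (a, c) \<in> r \<and> (b, c) \<in> r)"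

definition net_filter :: "'i set \<Rightarrow> 'i rel \<Rightarrow> 'i filter" where
  "net_filter A r = (INF a\<in>A. principal {b \<in> A. (a, b) \<in> r})"

lemma eventually_net_filter:
  assumes "directed_set A r"
  shows "eventually P (net_filter A r) \<longleftrightarrow> (\<exists>a\<in>A. \<forall>b\<in>A. (a, b) \<in> r \<longrightarrow> P b)"
proof -
  have tr: "\<And>a b c. (a, b) \<in> r \<Longrightarrow> (b, c) \<in> r \<Longrightarrow> (a, c) \<in> r"
    using assms unfolding directed_set_def preorder_on_def trans_def by blast
  have "eventually P (net_filter A r) \<longleftrightarrow>
      (\<exists>a\<in>A. eventually P (principal {b \<in> A. (a, b) \<in> r}))"
    unfolding net_filter_def
  proof (rule eventually_INF_base)
    show "A \<noteq> {}" using assms by (simp add: directed_set_def)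
  next
    fix a b assume "a \<in> A" "b \<in> A"
    then obtain c where "c \<in> A" "(a, c) \<in> r" "(b, c) \<in> r"
      using assms unfolding directed_set_def by blast
    then show "\<exists>c\<in>A. principal {d \<in> A. (c, d) \<in> r}
        \<le> inf (principal {d \<in> A. (a, d) \<in> r}) (principal {d \<in> A. (b, d) \<in> r})"
      using tr by (intro bexI[of _ c]) auto
  qed
  then show ?thesis by (auto simp: eventually_principal)
qed

definition prod_order :: "'i rel \<Rightarrow> 'j rel \<Rightarrow> ('i \<times> 'j) rel" where
  "prod_order r s = {((a, b), (a', b')). (a, a') \<in> r \<and> (b, b') \<in> s}"

definition decreases_to_zero :: "'i set \<Rightarrow> 'i rel \<Rightarrow> ('i \<Rightarrow> 'a::vector_lattice) \<Rightarrow> bool" where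
  "decreases_to_zero B s z \<longleftrightarrow>
     (\<forall>b\<in>B. \<forall>c\<in>B. (b, c) \<in> s \<longrightarrow> z c \<le> z b) \<and>
     (\<forall>b\<in>B. 0 \<le> z b) \<and> (\<forall>w. (\<forall>b\<in>B. w \<le> z b) \<longrightarrow> w \<le> 0)"

text \<open>Since types cannot be quantified, the dominating net is indexed by a subset of the vector
  lattice itself. This is no restriction, because a decreasing net can be reindexed by its range:
  see \<open>order_convergesI\<close>.\<close>

definition order_converges ::
    "'i set \<Rightarrow> 'i rel \<Rightarrow> ('i \<Rightarrow> 'a::vector_lattice) \<Rightarrow> 'a \<Rightarrow> bool" where
  "order_converges A r x l \<longleftrightarrow>
     (\<exists>(B :: 'a set) s z. directed_set B s \<and> decreases_to_zero B s z \<and>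
        (\<forall>b\<in>B. \<exists>a\<^sub>0\<in>A. \<forall>a\<in>A. (a\<^sub>0, a) \<in> r \<longrightarrow> \<bar>x a - l\<bar> \<le> z b))"

lemma order_convergesI:
  fixes z :: "'j \<Rightarrow> 'a::vector_lattice"
  assumes dir: "directed_set B s" and dec: "decreases_to_zero B s z"
    and dom: "\<And>b. b \<in> B \<Longrightarrow> \<exists>a\<^sub>0\<in>A. \<forall>a\<in>A. (a\<^sub>0, a) \<in> r \<longrightarrow> \<bar>x a - l\<bar> \<le> z b"
  shows "order_converges A r x l"
proof -
  let ?s = "{(u, v). u \<in> z ` B \<and> v \<in> z ` B \<and> v \<le> u}"
  have "\<exists>w\<in>z ` B. (u, w) \<in> ?s \<and> (v, w) \<in> ?s" if uv: "u \<in> z ` B" "v \<in> z ` B" for u v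
  proof -
    obtain b c where bc: "b \<in> B" "c \<in> B" "u = z b" "v = z c" using uv by blast
    then obtain d where "d \<in> B" "(b, d) \<in> s" "(c, d) \<in> s"
      using dir unfolding directed_set_def by blast
    then show ?thesis
      using bc dec unfolding decreases_to_zero_def by (intro bexI[of _ "z d"]) auto
  qed
  moreover have "preorder_on (z ` B) ?s"
    by (auto simp: preorder_on_def refl_on_def trans_def)
  ultimately have "directed_set (z ` B) ?s"
    using dir by (simp add: directed_set_def)
  moreover have "decreases_to_zero (z ` B) ?s id"
    using dec by (auto simp: decreases_to_zero_def)
  ultimately show ?thesis
    using dom unfolding order_converges_def
    by (intro exI[of _ "z ` B"] exI[of _ ?s] exI[of _ id]) auto
qed

definition uo_converges ::
    "'i set \<Rightarrow> 'i rel \<Rightarrow> ('i \<Rightarrow> 'a::vector_lattice) \<Rightarrow> 'a \<Rightarrow> bool" where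
  "uo_converges A r x l \<longleftrightarrow> (\<forall>y\<ge>0. order_converges A r (\<lambda>a. inf \<bar>x a - l\<bar> y) 0)"

definition uo_Cauchy :: "'i set \<Rightarrow> 'i rel \<Rightarrow> ('i \<Rightarrow> 'a::vector_lattice) \<Rightarrow> bool" where
  "uo_Cauchy A r x \<longleftrightarrow> uo_converges (A \<times> A) (prod_order r r) (\<lambda>(a, a'). x a - x a') 0"

text \<open>Again the nets are indexed by subsets of the space itself;
  \<open>order_continuousD\<close> extends the property to arbitrary nets.\<close>

definition order_continuous :: "'a::banach_lattice itself \<Rightarrow> bool" where
  "order_continuous _ \<longleftrightarrow>
     (\<forall>(A :: 'a set) r (x :: 'a \<Rightarrow> 'a). directed_set A r \<longrightarrow> order_converges A r x 0 \<longrightarrow>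
        (x \<longlongrightarrow> 0) (net_filter A r))"

lemma order_continuousD:
  fixes x :: "'i \<Rightarrow> 'a::banach_lattice"
  assumes oc: "order_continuous TYPE('a)" and dir: "directed_set A r"
    and null: "order_converges A r x 0"
  shows "(x \<longlongrightarrow> 0) (net_filter A r)"
proof -
  obtain B :: "'a set" and s z where B: "directed_set B s" "decreases_to_zero B s z"
    and dom: "\<And>b. b \<in> B \<Longrightarrow> \<exists>a\<^sub>0\<in>A. \<forall>a\<in>A. (a\<^sub>0, a) \<in> r \<longrightarrow> \<bar>x a - 0\<bar> \<le> z b"
    using null unfolding order_converges_def by blast
  have pos: "0 \<le> z b" if "b \<in> B" for b
    using B(2) that by (simp add: decreases_to_zero_def)
  have "order_converges B s z 0"
    using B pos by (intro order_convergesI[OF B]) (auto simp: decreases_to_zero_def)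
  then have z: "(z \<longlongrightarrow> 0) (net_filter B s)"
    using oc B(1) unfolding order_continuous_def by blast
  show ?thesis
  proof (rule tendstoI)
    fix e :: real assume "e > 0"
    then have "\<forall>\<^sub>F b in net_filter B s. dist (z b) 0 < e" using z by (rule tendstoD[rotated])
    then obtain b where b: "b \<in> B" "\<forall>c\<in>B. (b, c) \<in> s \<longrightarrow> norm (z c) < e"
      using B(1) by (auto simp: eventually_net_filter)
    have "(b, b) \<in> s"
      using B(1) b(1) unfolding directed_set_def preorder_on_def refl_on_def by blast
    then have zb: "norm (z b) < e" using b by blast
    obtain a\<^sub>0 where a0: "a\<^sub>0 \<in> A" "\<forall>a\<in>A. (a\<^sub>0, a) \<in> r \<longrightarrow> \<bar>x a\<bar> \<le> z b"
      using dom[OF b(1)] by auto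
    have "norm (x a) < e" if "a \<in> A" "(a\<^sub>0, a) \<in> r" for a
    proof -
      have "\<bar>x a\<bar> \<le> \<bar>z b\<bar>" using a0 that pos[OF b(1)] by simp
      then show ?thesis using norm_mono_abs zb by fastforce
    qed
    then show "\<forall>\<^sub>F a in net_filter A r. dist (x a) 0 < e"
      using dir a0(1) by (auto simp: eventually_net_filter)
  qed
qed

definition weak_topology :: "'a::real_normed_vector topology" where
  "weak_topology = topology_generated_by
     {blinfun_apply f -` U |(f :: 'a \<Rightarrow>\<^sub>L real) U. open U}"

definition relatively_weakly_compact :: "'a::real_normed_vector set \<Rightarrow> bool" where
  "relatively_weakly_compact S \<longleftrightarrow> compactin weak_topology (weak_topology closure_of S)"

definition positive_functional :: "('a::banach_lattice \<Rightarrow>\<^sub>L real) \<Rightarrow> bool" where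
  "positive_functional f \<longleftrightarrow> (\<forall>x\<ge>0. 0 \<le> blinfun_apply f x)"

definition abs_weak_topology :: "'a::banach_lattice topology" where
  "abs_weak_topology = topology_generated_by
     {{y. blinfun_apply f \<bar>y - c\<bar> < e} |(f :: 'a \<Rightarrow>\<^sub>L real) c e. positive_functional f \<and> 0 < e}"

end

theory Submission
  imports Defs
begin

text \<open>
  Let \<open>W\<close> be the set of members of the net and \<open>f\<close> a positive functional. The heart of the matter is
  that \<open>f \<bar>x\<^sub>a - x\<^sub>b\<bar> \<rightarrow> 0\<close>. Order continuity and the Cauchy hypothesis give only the truncated statement
  \<open>f (inf \<bar>x\<^sub>a - x\<^sub>b\<bar> w) \<rightarrow> 0\<close> for each fixed \<open>w \<ge> 0\<close>; what must be excluded is that mass escapes above every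
  \<open>w\<close>. This is what weak compactness does, in the manner of the Dunford-Pettis criterion for
  \<open>L\<^sup>1\<close>: for every \<open>e > 0\<close> there is \<open>u \<ge> 0\<close> with \<open>f (pprt (\<bar>x\<bar> - u)) \<le> e\<close> for all \<open>x \<in> W\<close>
  (\<open>almost_order_bounded\<close>).

  If there were no such \<open>u\<close>, one could choose \<open>x\<^sub>n \<in> W\<close> and pairwise disjoint \<open>0 \<le> v\<^sub>n \<le> \<bar>x\<^sub>n\<bar>\<close> with
  \<open>f v\<^sub>n\<close> bounded away from zero. The sublinear functional that restricts \<open>f \<bar>\<cdot>\<bar>\<close> to the band generated by
  \<open>v\<^sub>n\<close> is, by the Hahn-Banach theorem, touched at \<open>x\<^sub>n\<close> by a linear functional \<open>g\<^sub>n\<close>; disjointness makes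
  \<open>y \<mapsto> (g\<^sub>n y)\<^sub>n\<close> a bounded map into \<open>\<ell>\<^sup>1\<close>. The image of \<open>W\<close> in \<open>\<ell>\<^sup>1\<close> is relatively weakly compact but
  has coordinates \<open>g\<^sub>n x\<^sub>n\<close> bounded away from zero, which a gliding hump argument in the spirit of
  Schur's theorem refutes (\<open>gliding_hump\<close>). Cluster points of sequences
  here take the place of weakly convergent subsequences, and Hahn-Banach that of band projections.

  The rest is soft. Let \<open>l\<close> be a weak cluster point of the net. Since \<open>z \<mapsto> f \<bar>z\<bar>\<close> is a supremum of
  functionals, letting \<open>x\<^sub>b\<close> cluster at \<open>l\<close> in \<open>f \<bar>x\<^sub>a - x\<^sub>b\<bar> \<le> e\<close> gives \<open>f \<bar>x\<^sub>a - l\<bar> \<le> e\<close>, so the net converges to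
  \<open>l\<close> in the absolute weak topology (\<open>weak_cluster_point_abs_le\<close>). The order bounds
  \<open>inf \<bar>x\<^sub>a - x\<^sub>b\<bar> y \<le> z\<close> of the Cauchy condition pass to the limit in \<open>b\<close>, because positive functionals
  determine the order; this is uo-convergence to \<open>l\<close> (\<open>uo_Cauchy_abs_weak_limit\<close>).
\<close>

section \<open>Inequalities in vector lattices\<close>

lemma scaleR_sup_nonneg:
  fixes x y :: "'a::vector_lattice"
  assumes "0 \<le> c"
  shows "c *\<^sub>R sup x y = sup (c *\<^sub>R x) (c *\<^sub>R y)"
proof (cases "c = 0")
  case False
  then have c: "0 < c" using assms by simp
  let ?s = "sup (c *\<^sub>R x) (c *\<^sub>R y)"
  have "u \<le> inverse c *\<^sub>R ?s" if "c *\<^sub>R u \<le> ?s" for u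
    using scaleR_left_mono[OF that, of "inverse c"] c by simp
  then have "sup x y \<le> inverse c *\<^sub>R ?s" by (intro le_supI) auto
  from scaleR_left_mono[OF this assms] have "c *\<^sub>R sup x y \<le> ?s" using c by simp
  then show ?thesis
    using assms by (intro order.antisym le_supI scaleR_left_mono) auto
qed simp

lemma scaleR_inf_nonneg:
  fixes x y :: "'a::vector_lattice"
  assumes "0 \<le> c"
  shows "c *\<^sub>R inf x y = inf (c *\<^sub>R x) (c *\<^sub>R y)"
  using scaleR_sup_nonneg[OF assms, of "- x" "- y"]
  by (simp add: inf_eq_neg_sup del: neg_sup_eq_inf)

lemma abs_scaleR_nonneg:
  fixes x :: "'a::vector_lattice"
  assumes "0 \<le> c"
  shows "\<bar>c *\<^sub>R x\<bar> = c *\<^sub>R \<bar>x\<bar>"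
  using scaleR_sup_nonneg[OF assms, of x "- x"] by (simp add: abs_lattice)

lemma pprt_scaleR_nonneg:
  fixes x :: "'a::vector_lattice"
  assumes "0 \<le> c"
  shows "pprt (c *\<^sub>R x) = c *\<^sub>R pprt x"
  using scaleR_sup_nonneg[OF assms, of x 0] by (simp add: pprt_def)

lemma pprt_add_le:
  fixes x y :: "'a::vector_lattice"
  shows "pprt (x + y) \<le> pprt x + pprt y"
  unfolding pprt_def by (intro le_supI add_mono add_nonneg_nonneg) auto

text \<open>
  Expanding the right-hand side by translation invariance gives a fourfold infimum, each term of
  which dominates the left-hand side.
\<close>

lemma inf_add_le:
  fixes x y z :: "'a::vector_lattice"
  assumes "0 \<le> x" "0 \<le> y" "0 \<le> z"
  shows "inf (x + y) z \<le> inf x z + inf y z"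
proof -
  have "inf x z + inf y z = inf (inf (x + y) (x + z)) (inf (z + y) (z + z))"
    by (simp add: add_inf_distrib_left add_inf_distrib_right inf_aci)
  moreover have "z \<le> x + z" "z \<le> z + y" "z \<le> z + z" using assms by simp_all
  ultimately show ?thesis by (simp add: le_infI2)
qed

lemma inf_pprt_pprt_uminus:
  fixes x :: "'a::vector_lattice"
  shows "inf (pprt x) (pprt (- x)) = 0"
proof -
  have "pprt (- x) = pprt x + - x"
    using prts[of x] by (simp add: pprt_neg algebra_simps)
  then have "inf (pprt x) (pprt (- x)) = pprt x + inf 0 (- x)"
    by (simp add: add_inf_distrib_left)
  also have "inf 0 (- x) = - pprt x"
    by (simp add: pprt_def inf_commute)
  finally show ?thesis by simp
qed

lemma inf_scaleR_eq_0:
  fixes u v :: "'a::vector_lattice"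
  assumes "0 \<le> u" "0 \<le> v" "inf u v = 0" "0 \<le> a" "0 \<le> b"
  shows "inf (a *\<^sub>R u) (b *\<^sub>R v) = 0"
proof (rule order.antisym)
  have "inf (a *\<^sub>R u) (b *\<^sub>R v) \<le> inf (max a b *\<^sub>R u) (max a b *\<^sub>R v)"
    using assms by (intro inf_mono scaleR_right_mono) auto
  also have "\<dots> = max a b *\<^sub>R inf u v"
    using assms by (intro scaleR_inf_nonneg[symmetric]) auto
  finally show "inf (a *\<^sub>R u) (b *\<^sub>R v) \<le> 0" using assms by simp
qed (use assms in \<open>simp add: scaleR_nonneg_nonneg\<close>)

text \<open>
  The source of disjoint elements: if \<open>a\<close> exceeds \<open>s b\<close> in some place, then there \<open>b\<close> cannot
  exceed \<open>t a \<ge> a / s\<close>. Formally, the second element is at most a multiple of the negative part of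
  \<open>a - s b\<close>.
\<close>

lemma inf_pprt_diff_eq_0:
  fixes a b :: "'a::vector_lattice"
  assumes "0 \<le> a" "0 < s" "1 \<le> s * t"
  shows "inf (pprt (a - s *\<^sub>R b)) (pprt (b - t *\<^sub>R a)) = 0"
proof (rule order.antisym)
  have "inverse s *\<^sub>R a \<le> t *\<^sub>R a"
    using assms by (intro scaleR_right_mono) (auto simp: field_simps)
  then have "b - t *\<^sub>R a \<le> inverse s *\<^sub>R (- (a - s *\<^sub>R b))"
    using assms by (simp add: algebra_simps)
  then have "pprt (b - t *\<^sub>R a) \<le> inverse s *\<^sub>R pprt (- (a - s *\<^sub>R b))"
    using assms by (metis pprt_mono pprt_scaleR_nonneg inverse_nonnegative_iff_nonnegative less_imp_le)
  then have "inf (pprt (a - s *\<^sub>R b)) (pprt (b - t *\<^sub>R a)) 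
     \<le> inf (1 *\<^sub>R pprt (a - s *\<^sub>R b)) (inverse s *\<^sub>R pprt (- (a - s *\<^sub>R b)))"
    by (intro inf_mono) auto
  also have "\<dots> = 0"
    using assms by (intro inf_scaleR_eq_0 inf_pprt_pprt_uminus) auto
  finally show "inf (pprt (a - s *\<^sub>R b)) (pprt (b - t *\<^sub>R a)) \<le> 0" .
qed simp

text \<open>
  A sum of two disjoint positive elements is their supremum, and a partial sum stays disjoint
  from the next summand.
\<close>

lemma sum_disjoint_le:
  fixes u :: "'i \<Rightarrow> 'a::vector_lattice"
  assumes "finite F" "\<And>i. i \<in> F \<Longrightarrow> 0 \<le> u i" "\<And>i. i \<in> F \<Longrightarrow> u i \<le> w" "0 \<le> w"
    and "\<And>i j. i \<in> F \<Longrightarrow> j \<in> F \<Longrightarrow> i \<noteq> j \<Longrightarrow> inf (u i) (u j) = 0"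
  shows "sum u F \<le> w"
  using assms
proof (induction F rule: finite_induct)
  case (insert j F)
  have "inf (sum u G) (u j) = 0" if "finite G" "G \<subseteq> F" for G
    using that
  proof (induction G rule: finite_induct)
    case (insert i G)
    have "inf (u i + sum u G) (u j) \<le> inf (u i) (u j) + inf (sum u G) (u j)"
      using insert.prems \<open>\<And>i. i \<in> Set.insert j F \<Longrightarrow> 0 \<le> u i\<close>
      by (intro inf_add_le sum_nonneg) auto
    also have "\<dots> = 0"
      using insert insert.prems \<open>j \<notin> F\<close>
        \<open>\<And>i k. i \<in> Set.insert j F \<Longrightarrow> k \<in> Set.insert j F \<Longrightarrow> i \<noteq> k \<Longrightarrow> inf (u i) (u k) = 0\<close>[of i j]
      by auto
    finally have "inf (u i + sum u G) (u j) \<le> 0" .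
    moreover have "0 \<le> u i + sum u G"
      using insert.prems \<open>\<And>i. i \<in> Set.insert j F \<Longrightarrow> 0 \<le> u i\<close>
      by (intro add_nonneg_nonneg sum_nonneg) auto
    ultimately show ?case
      using insert.hyps insert.prems \<open>\<And>i. i \<in> Set.insert j F \<Longrightarrow> 0 \<le> u i\<close>
      by (auto intro!: order.antisym)
  qed (use insert.prems in \<open>simp add: inf_absorb1\<close>)
  then have "u j + sum u F = sup (sum u F) (u j)"
    using add_eq_inf_sup[of "sum u F" "u j"] insert.hyps by (simp add: add.commute)
  also have "\<dots> \<le> w"
    using insert by (intro le_supI) auto
  finally show ?case using insert.hyps by simp
qed simp

lemma inf_le_inf_plus_abs_diff:
  fixes a b y :: "'a::vector_lattice"
  shows "inf a y \<le> inf b y + \<bar>a - b\<bar>"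
proof -
  have "a \<le> b + \<bar>a - b\<bar>" using abs_ge_self[of "a - b"] by (simp add: algebra_simps)
  moreover have "y \<le> y + \<bar>a - b\<bar>" by simp
  ultimately show ?thesis
    unfolding add_inf_distrib_right by (intro inf_mono)
qed

text \<open>
  Truncation at \<open>w\<close>: the part of \<open>d\<close> below \<open>w\<close> and the excess over \<open>w\<close>.
\<close>

lemma eq_inf_add_pprt:
  fixes d w :: "'a::vector_lattice"
  shows "d = inf d w + pprt (d - w)"
proof -
  have "pprt (d - w) = sup d w - w"
    using add_sup_distrib_right[of d w "- w"] by (simp add: pprt_def)
  then show ?thesis using add_eq_inf_sup[of d w] by (metis add_diff_cancel_right' add.commute diff_add_eq)
qed

lemma norm_abs_lattice:
  fixes x :: "'a::banach_lattice"
  shows "norm \<bar>x\<bar> = norm x"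
  by (intro order.antisym norm_mono_abs) auto

lemma norm_mono_nonneg:
  fixes x y :: "'a::banach_lattice"
  assumes "0 \<le> x" "x \<le> y"
  shows "norm x \<le> norm y"
  using assms by (intro norm_mono_abs) (auto intro: order_trans)

section \<open>The Hahn-Banach theorem and positive functionals\<close>

definition sublinear :: "('a::real_vector \<Rightarrow> real) \<Rightarrow> bool" where
  "sublinear p \<longleftrightarrow> (\<forall>x y. p (x + y) \<le> p x + p y) \<and> (\<forall>c x. 0 < c \<longrightarrow> p (c *\<^sub>R x) = c * p x)"

lemma sublinearI:
  assumes "\<And>x y. p (x + y) \<le> p x + p y" "\<And>c x. 0 < c \<Longrightarrow> p (c *\<^sub>R x) \<le> c * p x"
  shows "sublinear p"
proof -
  have "c * p x \<le> p (c *\<^sub>R x)" if "0 < c" for c x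
    using assms(2)[of "inverse c" "c *\<^sub>R x"] that by (simp add: field_simps)
  then show ?thesis unfolding sublinear_def using assms by (auto intro: order.antisym)
qed

lemma sublinear_add: "sublinear p \<Longrightarrow> p (x + y) \<le> p x + p y"
  by (simp add: sublinear_def)

lemma sublinear_scaleR: "sublinear p \<Longrightarrow> 0 < c \<Longrightarrow> p (c *\<^sub>R x) = c * p x"
  by (simp add: sublinear_def)

lemma sublinear_zero: "sublinear p \<Longrightarrow> p 0 = 0"
  using sublinear_scaleR[of p 2 0] by simp

lemma sublinear_uminus: "sublinear p \<Longrightarrow> - p (- x) \<le> p x"
  using sublinear_add[of p x "- x"] sublinear_zero[of p] by simp

text \<open>
  The engine of the Hahn-Banach theorem: take for \<open>q' y\<close> the infimum of \<open>q (y + t z) - t q z\<close> over \<open>t \<ge> 0\<close>,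
  which gives the largest sublinear functional below \<open>q\<close> with \<open>q' (- z) \<le> - q z\<close>. This forces additivity in the direction \<open>z\<close>
  on anything that cannot be lowered further.
\<close>

lemma sublinear_directional:
  assumes q: "sublinear q"
  shows "\<exists>q'. sublinear q' \<and> (\<forall>y. q' y \<le> q y) \<and> (\<forall>y. q' y \<le> q (y + z) - q z)"
proof -
  define q' where "q' y = (INF t\<in>{0..}. q (y + t *\<^sub>R z) - t * q z)" for y
  have bdd: "bdd_below ((\<lambda>t. q (y + t *\<^sub>R z) - t * q z) ` {0..})" for y
  proof (rule bdd_belowI2)
    fix t :: real assume "t \<in> {0..}"
    then have "q (t *\<^sub>R z) = t * q z"
      using q by (cases "t = 0") (auto simp: sublinear_zero sublinear_scaleR)
    then show "- q (- y) \<le> q (y + t *\<^sub>R z) - t * q z"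
      using sublinear_add[OF q, of "y + t *\<^sub>R z" "- y"] by simp
  qed
  have le: "q' y \<le> q (y + t *\<^sub>R z) - t * q z" if "0 \<le> t" for y t
    unfolding q'_def using that by (intro cINF_lower bdd) auto
  have ge: "m \<le> q' y" if "\<And>t. 0 \<le> t \<Longrightarrow> m \<le> q (y + t *\<^sub>R z) - t * q z" for m y
    unfolding q'_def using that by (intro cINF_greatest) auto
  have "sublinear q'"
  proof (rule sublinearI)
    fix x y
    have "q' (x + y) - q' x \<le> q (y + t *\<^sub>R z) - t * q z" if t: "0 \<le> t" for t
    proof -
      have "q' (x + y) - (q (y + t *\<^sub>R z) - t * q z) \<le> q (x + s *\<^sub>R z) - s * q z" if s: "0 \<le> s" for s
        using le[of "s + t" "x + y"] s t sublinear_add[OF q, of "x + s *\<^sub>R z" "y + t *\<^sub>R z"]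
        by (simp add: algebra_simps)
      from ge[OF this] show ?thesis by simp
    qed
    from ge[OF this] show "q' (x + y) \<le> q' x + q' y" by simp
  next
    fix c :: real and x assume c: "0 < c"
    have "inverse c * q' (c *\<^sub>R x) \<le> q (x + t *\<^sub>R z) - t * q z" if t: "0 \<le> t" for t
    proof -
      have "q' (c *\<^sub>R x) \<le> q (c *\<^sub>R (x + t *\<^sub>R z)) - (c * t) * q z"
        using le[of "c * t" "c *\<^sub>R x"] c t by (simp add: scaleR_add_right)
      also have "\<dots> = c * (q (x + t *\<^sub>R z) - t * q z)"
        using sublinear_scaleR[OF q c, of "x + t *\<^sub>R z"] by (simp add: right_diff_distrib)
      finally show ?thesis using c by (simp add: field_simps)
    qed
    from ge[OF this] show "q' (c *\<^sub>R x) \<le> c * q' x" using c by (simp add: field_simps)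
  qed
  then show ?thesis using le[of 0] le[of 1] by (intro exI[of _ q']) auto
qed

text \<open>
  By Zorn's lemma: the pointwise infimum of a chain is bounded below by \<open>- p (- y)\<close> and is again
  sublinear.
\<close>

lemma exists_minimal_sublinear:
  assumes p: "sublinear p"
  shows "\<exists>m. sublinear m \<and> (\<forall>y. m y \<le> p y) \<and>
    (\<forall>q. sublinear q \<longrightarrow> (\<forall>y. q y \<le> m y) \<longrightarrow> q = m)"
proof -
  define A where "A = {q. sublinear q \<and> (\<forall>y. q y \<le> p y)}"
  define P where "P q q' \<longleftrightarrow> (\<forall>y. q' y \<le> q y)" for q q' :: "'a \<Rightarrow> real"
  have "\<exists>m\<in>A. \<forall>a\<in>A. P m a \<longrightarrow> a = m"
  proof (rule predicate_Zorn)
    show "partial_order_on A (relation_of P A)"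
      by (intro partial_order_on_relation_ofI)
        (auto simp: P_def fun_eq_iff intro: order.trans order.antisym)
  next
    fix C assume C: "C \<in> Chains (relation_of P A)"
    then have sub: "C \<subseteq> A" by (auto simp: Chains_def relation_of_def)
    have lin: "P a b \<or> P b a" if "a \<in> C" "b \<in> C" for a b
      using C that by (auto simp: Chains_def relation_of_def)
    show "\<exists>u\<in>A. \<forall>a\<in>C. P a u"
    proof (cases "C = {}")
      case True
      then show ?thesis using p by (auto simp: A_def)
    next
      case False
      define u where "u y = (INF q\<in>C. q y)" for y
      have bdd: "bdd_below ((\<lambda>q. q y) ` C)" for y
      proof (rule bdd_belowI2)
        fix q assume "q \<in> C"
        then have "sublinear q" "q (- y) \<le> p (- y)" using sub by (auto simp: A_def)
        then show "- p (- y) \<le> q y" using sublinear_uminus[of q y] by simp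
      qed
      have le: "u y \<le> q y" if "q \<in> C" for q y
        unfolding u_def using that by (intro cINF_lower bdd)
      have ge: "m \<le> u y" if "\<And>q. q \<in> C \<Longrightarrow> m \<le> q y" for m y
        unfolding u_def using that False by (intro cINF_greatest) auto
      have "sublinear u"
      proof (rule sublinearI)
        fix x y
        have "u (x + y) - u x \<le> q y" if q: "q \<in> C" for q
        proof -
          have "u (x + y) - q y \<le> q' x" if q': "q' \<in> C" for q'
          proof -
            obtain s where s: "s \<in> C" "s x \<le> q' x" "s y \<le> q y"
              using lin[OF q q'] q q' unfolding P_def by blast
            then have "sublinear s" using sub by (auto simp: A_def)
            then show ?thesis using le[OF s(1), of "x + y"] sublinear_add[of s x y] s by simp
          qed
          then have "u (x + y) - q y \<le> u x" by (rule ge)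
          then show ?thesis by simp
        qed
        then have "u (x + y) - u x \<le> u y" by (rule ge)
        then show "u (x + y) \<le> u x + u y" by simp
      next
        fix c :: real and x assume c: "0 < c"
        have "inverse c * u (c *\<^sub>R x) \<le> q x" if q: "q \<in> C" for q
        proof -
          have "sublinear q" using q sub by (auto simp: A_def)
          then show ?thesis
            using le[OF q, of "c *\<^sub>R x"] c by (simp add: sublinear_scaleR field_simps)
        qed
        then have "inverse c * u (c *\<^sub>R x) \<le> u x" by (rule ge)
        then show "u (c *\<^sub>R x) \<le> c * u x" using c by (simp add: field_simps)
      qed
      moreover have "u y \<le> p y" for y
        using False le sub unfolding A_def by (force intro: order.trans)
      ultimately show ?thesis using le by (auto simp: A_def P_def)
    qed
  qed
  then obtain m where m: "m \<in> A" "\<And>a. a \<in> A \<Longrightarrow> P m a \<Longrightarrow> a = m" by blast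
  then show ?thesis
    unfolding A_def P_def by (intro exI[of _ m]) (auto intro: order.trans)
qed

text \<open>
  Lower \<open>p\<close> in the direction \<open>z\<close> and take a minimal sublinear functional below the result. Lowering it
  further in any direction changes nothing, so it is superadditive, hence linear, and it still takes
  the value \<open>p z\<close> at \<open>z\<close>.
\<close>

lemma Hahn_Banach_touching:
  fixes p :: "'a::real_vector \<Rightarrow> real"
  assumes p: "sublinear p"
  shows "\<exists>g. linear g \<and> (\<forall>y. g y \<le> p y) \<and> g z = p z"
proof -
  obtain p' where p': "sublinear p'" "\<And>y. p' y \<le> p y" "\<And>y. p' y \<le> p (y + z) - p z"
    using sublinear_directional[OF p, of z] by blast
  obtain g where g: "sublinear g" "\<And>y. g y \<le> p' y"
    and min: "\<And>q. sublinear q \<Longrightarrow> (\<And>y. q y \<le> g y) \<Longrightarrow> q = g"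
    using exists_minimal_sublinear[OF p'(1)] by metis
  have "g x + g y \<le> g (x + y)" for x y
  proof -
    obtain q where "sublinear q" "\<And>y. q y \<le> g y" "\<And>y'. q y' \<le> g (y' + y) - g y"
      using sublinear_directional[OF g(1), of y] by blast
    then show ?thesis using min[of q] by (metis le_diff_eq)
  qed
  then have add: "g (x + y) = g x + g y" for x y
    using sublinear_add[OF g(1), of x y] by (metis order.antisym)
  have neg: "g (- x) = - g x" for x
    using add[of x "- x"] sublinear_zero[OF g(1)] by simp
  have "g (c *\<^sub>R x) = c * g x" for c x
  proof -
    consider "c = 0" | "0 < c" | "0 < - c" by linarith
    then show ?thesis
    proof cases
      case 3
      then show ?thesis using sublinear_scaleR[OF g(1) 3, of x] neg[of "c *\<^sub>R x"] by simp
    qed (auto simp: sublinear_zero[OF g(1)] sublinear_scaleR[OF g(1)])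
  qed
  then have "linear g" using add by (intro linearI) auto
  moreover have "g z = p z"
  proof (rule order.antisym)
    show "g z \<le> p z" using g(2) p'(2) by (rule order.trans)
    have "g (- z) \<le> - p z"
      using g(2)[of "- z"] p'(3)[of "- z"] sublinear_zero[OF p] by simp
    then show "p z \<le> g z" by (simp add: neg)
  qed
  ultimately show ?thesis using g(2) p'(2) by (meson order.trans)
qed

lemma Hahn_Banach_bounded:
  fixes p :: "'a::real_normed_vector \<Rightarrow> real"
  assumes p: "sublinear p" and bd: "\<And>y. p y \<le> C * norm y"
  obtains g :: "'a \<Rightarrow>\<^sub>L real" where "\<And>y. blinfun_apply g y \<le> p y" "blinfun_apply g z = p z"
proof -
  obtain g where g: "linear g" "\<And>y. g y \<le> p y" "g z = p z"
    using Hahn_Banach_touching[OF p] by blast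
  have "\<bar>g y\<bar> \<le> C * norm y" for y
    using g(2)[of y] g(2)[of "- y"] bd[of y] bd[of "- y"] linear_neg[OF g(1), of y] by simp
  then have "bounded_linear g"
    using g(1) by (intro bounded_linear_intro[of g C])
      (auto simp: linear_add linear_scale mult.commute)
  then show thesis
    using that[of "Blinfun g"] g by (simp add: bounded_linear_Blinfun_apply)
qed

lemma norming_functional:
  fixes z :: "'a::real_normed_vector"
  obtains g :: "'a \<Rightarrow>\<^sub>L real" where "norm g \<le> 1" "blinfun_apply g z = norm z"
proof -
  obtain g :: "'a \<Rightarrow>\<^sub>L real" where g: "\<And>y. blinfun_apply g y \<le> norm y" "blinfun_apply g z = norm z"
    by (rule Hahn_Banach_bounded[of norm 1 z]) (auto intro!: sublinearI norm_triangle_ineq)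
  have "\<bar>blinfun_apply g y\<bar> \<le> 1 * norm y" for y
    using g(1)[of y] g(1)[of "- y"] by (simp add: blinfun.minus_right)
  then have "norm g \<le> 1" by (intro norm_blinfun_bound) auto
  then show thesis using g(2) that by blast
qed

lemma positive_functional_mono:
  assumes "positive_functional f" "x \<le> y"
  shows "blinfun_apply f x \<le> blinfun_apply f y"
  using assms unfolding positive_functional_def
  by (metis blinfun.diff_right diff_ge_0_iff_ge)

text \<open>
  If \<open>x \<le> y\<close> failed, a functional below \<open>u \<mapsto> norm (pprt u)\<close> touching it at \<open>x - y\<close> would be positive
  and strictly positive at \<open>x - y\<close>. As a by-product the positive cone is closed under limits, which is
  used below for infinite sums and for nets.
\<close>

lemma le_if_positive_functionals_le:
  fixes x y :: "'a::banach_lattice"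
  assumes "\<And>f :: 'a \<Rightarrow>\<^sub>L real. positive_functional f \<Longrightarrow> blinfun_apply f x \<le> blinfun_apply f y"
  shows "x \<le> y"
proof -
  have le: "norm (pprt u) \<le> norm u" for u :: 'a
  proof (rule norm_mono_abs)
    show "\<bar>pprt u\<bar> \<le> \<bar>u\<bar>" by (simp add: pprt_def abs_ge_self)
  qed
  have "norm (pprt (u + v)) \<le> norm (pprt u) + norm (pprt v)" for u v :: 'a
    using norm_mono_nonneg[OF zero_le_pprt pprt_add_le[of u v]] norm_triangle_ineq
    by (rule order.trans)
  then have "sublinear (\<lambda>u::'a. norm (pprt u))"
    by (intro sublinearI) (auto simp: pprt_scaleR_nonneg)
  then obtain g :: "'a \<Rightarrow>\<^sub>L real" where g: "\<And>u. blinfun_apply g u \<le> norm (pprt u)"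
    "blinfun_apply g (x - y) = norm (pprt (x - y))"
    using Hahn_Banach_bounded[of "\<lambda>u. norm (pprt u)" 1 "x - y"] le by auto
  have "positive_functional g"
    unfolding positive_functional_def
  proof (intro allI impI)
    fix u :: 'a assume "0 \<le> u"
    then show "0 \<le> blinfun_apply g u" using g(1)[of "- u"] by (simp add: blinfun.minus_right)
  qed
  then have "blinfun_apply g (x - y) \<le> 0" using assms[of g] by (simp add: blinfun.diff_right)
  then have "pprt (x - y) = 0" using g(2) by simp
  then show ?thesis using le_zero_iff_zero_pprt[of "x - y"] by simp
qed

lemma sublinear_functional_abs:
  assumes "positive_functional f"
  shows "sublinear (\<lambda>x. blinfun_apply f \<bar>x\<bar>)"
proof (rule sublinearI)
  show "blinfun_apply f \<bar>x + y\<bar> \<le> blinfun_apply f \<bar>x\<bar> + blinfun_apply f \<bar>y\<bar>" for x y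
    using positive_functional_mono[OF assms abs_triangle_ineq] by (simp add: blinfun.add_right)
qed (simp add: abs_scaleR_nonneg blinfun.scaleR_right)

lemma functional_abs_le_norm:
  fixes f :: "'a::banach_lattice \<Rightarrow>\<^sub>L real"
  shows "blinfun_apply f \<bar>x\<bar> \<le> norm f * norm x"
  using norm_blinfun[of f "\<bar>x\<bar>"] by (simp add: norm_abs_lattice)


section \<open>Weak cluster points\<close>

lemma topspace_weak_topology: "topspace (weak_topology :: 'a::real_normed_vector topology) = UNIV"
proof -
  have "blinfun_apply (0 :: 'a \<Rightarrow>\<^sub>L real) -` UNIV \<in>
      {blinfun_apply f -` U |(f :: 'a \<Rightarrow>\<^sub>L real) U. open U}"
    by blast
  then show ?thesis
    unfolding weak_topology_def by (auto simp: topology_generated_by_topspace)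
qed

lemma openin_weak_topology_finite:
  fixes l :: "'a::real_normed_vector"
  assumes "finite (G :: ('a \<Rightarrow>\<^sub>L real) set)"
  shows "openin weak_topology {y. \<forall>g\<in>G. \<bar>blinfun_apply g y - blinfun_apply g l\<bar> < e}"
proof -
  have "openin weak_topology (blinfun_apply g -` ball (blinfun_apply g l) e)" for g :: "'a \<Rightarrow>\<^sub>L real"
    unfolding weak_topology_def by (rule topology_generated_by_Basis) blast
  then have "openin weak_topology
      ((\<Inter>g\<in>G. blinfun_apply g -` ball (blinfun_apply g l) e) \<inter> topspace weak_topology)"
    using assms by (intro openin_INT)
  then show ?thesis
    by (rule back_subst[of "openin _"])
      (auto simp: topspace_weak_topology dist_real_def abs_minus_commute)
qed

text \<open>
  Cluster points are phrased by finitely many functionals at a time, that is, by the basic weak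
  neighbourhoods of \<open>l\<close>, because this is the form in which they are used.
\<close>

definition weak_cluster_point :: "'i filter \<Rightarrow> ('i \<Rightarrow> 'a::real_normed_vector) \<Rightarrow> 'a \<Rightarrow> bool" where
  "weak_cluster_point F s l \<longleftrightarrow> (\<forall>(G :: ('a \<Rightarrow>\<^sub>L real) set) e. finite G \<longrightarrow> 0 < e \<longrightarrow>
     (\<exists>\<^sub>F i in F. \<forall>g\<in>G. \<bar>blinfun_apply g (s i) - blinfun_apply g l\<bar> < e))"

lemma weak_cluster_pointD:
  fixes g :: "'a::real_normed_vector \<Rightarrow>\<^sub>L real"
  assumes "weak_cluster_point F s l" "0 < e"
  shows "\<exists>\<^sub>F i in F. \<bar>blinfun_apply g (s i) - blinfun_apply g l\<bar> < e"
  using assms(1)[unfolded weak_cluster_point_def, rule_format, of "{g}" e] assms(2) by simp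

lemma eventually_and_frequently_ex:
  assumes "eventually P F" "frequently Q F"
  shows "\<exists>i. P i \<and> Q i"
proof (rule frequently_ex, rule frequently_rev_mp)
  show "frequently Q F" by fact
  show "\<forall>\<^sub>F i in F. Q i \<longrightarrow> P i \<and> Q i" using assms(1) by (rule eventually_mono) simp
qed

text \<open>
  The weak closures of the tails have the finite intersection property inside the weak closure
  of \<open>W\<close>; any common point is a cluster point.
\<close>

lemma weak_cluster_point_exists:
  fixes s :: "'i \<Rightarrow> 'a::real_normed_vector"
  assumes W: "relatively_weakly_compact W" and F: "F \<noteq> bot" and s: "\<forall>\<^sub>F i in F. s i \<in> W"
  obtains l where "weak_cluster_point F s l"
proof -
  define K where "K P = weak_topology closure_of (s ` {i. P i \<and> s i \<in> W})" for P
  define \<U> where "\<U> = {K P | P. eventually P F}"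
  have sub: "s i \<in> K P" if "P i" "s i \<in> W" for i P
    unfolding K_def using that
      closure_of_subset[of "s ` {i. P i \<and> s i \<in> W}" "weak_topology :: 'a topology"]
    by (auto simp: topspace_weak_topology)
  have "(weak_topology closure_of W) \<inter> \<Inter>\<U> \<noteq> {}"
  proof -
    have "(weak_topology closure_of W) \<inter> \<Inter>\<F> \<noteq> {}" if fin: "finite \<F>" "\<F> \<subseteq> \<U>" for \<F>
    proof -
      have "\<forall>C\<in>\<F>. \<exists>P. eventually P F \<and> C = K P" using fin by (auto simp: \<U>_def)
      from bchoice[OF this] obtain P
        where P: "C \<in> \<F> \<Longrightarrow> eventually (P C) F" "C \<in> \<F> \<Longrightarrow> C = K (P C)" for C
        by blast
      have "\<forall>\<^sub>F i in F. s i \<in> W \<and> (\<forall>C\<in>\<F>. P C i)"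
        using s P(1) fin by (simp add: eventually_conj_iff eventually_ball_finite)
      from eventually_happens'[OF F this]
      obtain i where i: "s i \<in> W" "C \<in> \<F> \<Longrightarrow> P C i" for C
        by blast
      have "s i \<in> weak_topology closure_of W"
        using closure_of_subset[of W weak_topology] i(1) by (auto simp: topspace_weak_topology)
      moreover have "s i \<in> C" if "C \<in> \<F>" for C
        using sub[of "P C" i, OF i(2)[OF that] i(1)] P(2)[OF that] by simp
      ultimately show ?thesis by blast
    qed
    moreover have "\<forall>C\<in>\<U>. closedin weak_topology C" by (auto simp: \<U>_def K_def)
    ultimately show ?thesis
      using W[unfolded relatively_weakly_compact_def compactin_fip, THEN conjunct2, rule_format, of \<U>]
      by simp
  qed
  then obtain l where "l \<in> \<Inter>\<U>" by auto
  then have l: "l \<in> K P" if "eventually P F" for P using that by (auto simp: \<U>_def)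
  have "weak_cluster_point F s l"
    unfolding weak_cluster_point_def
  proof (intro allI impI, rule ccontr)
    fix G :: "('a \<Rightarrow>\<^sub>L real) set" and e :: real
    assume G: "finite G" "0 < e"
      and never: "\<not> (\<exists>\<^sub>F i in F. \<forall>g\<in>G. \<bar>blinfun_apply g (s i) - blinfun_apply g l\<bar> < e)"
    define T where "T = {y. \<forall>g\<in>G. \<bar>blinfun_apply g y - blinfun_apply g l\<bar> < e}"
    have "\<forall>\<^sub>F i in F. s i \<notin> T"
      using never by (simp add: T_def frequently_def)
    then have "l \<in> weak_topology closure_of (s ` {i. s i \<notin> T \<and> s i \<in> W})"
      unfolding K_def[symmetric] by (rule l)
    moreover have "l \<in> T" using G by (simp add: T_def)
    moreover have "openin weak_topology T"
      unfolding T_def by (rule openin_weak_topology_finite[OF G(1)])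
    ultimately obtain y where "y \<in> s ` {i. s i \<notin> T \<and> s i \<in> W}" "y \<in> T"
      unfolding in_closure_of by blast
    then show False by blast
  qed
  then show thesis by (rule that)
qed

lemma weak_cluster_point_eq:
  fixes g :: "'a::real_normed_vector \<Rightarrow>\<^sub>L real"
  assumes cl: "weak_cluster_point F s l"
    and lim: "((\<lambda>i. blinfun_apply g (s i)) \<longlongrightarrow> c) F"
  shows "blinfun_apply g l = c"
proof (rule ccontr)
  assume "blinfun_apply g l \<noteq> c"
  then have e: "0 < \<bar>blinfun_apply g l - c\<bar> / 2" (is "0 < ?e") by simp
  have "\<forall>\<^sub>F i in F. dist (blinfun_apply g (s i)) c < ?e"
    using lim e by (rule tendstoD)
  then have "\<forall>\<^sub>F i in F. \<bar>blinfun_apply g (s i) - blinfun_apply g l\<bar> < ?e \<longrightarrow> False"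
  proof eventually_elim
    case (elim i)
    have "\<bar>blinfun_apply g l - c\<bar>
        \<le> \<bar>blinfun_apply g (s i) - blinfun_apply g l\<bar> + \<bar>blinfun_apply g (s i) - c\<bar>"
      by linarith
    with elim show ?case unfolding dist_real_def by auto
  qed
  with weak_cluster_pointD[OF cl e] have "\<exists>\<^sub>F i in F. False" by (rule frequently_rev_mp)
  then show False by simp
qed

text \<open>
  The uniform boundedness principle. Every functional is bounded on \<open>W\<close>, since a sequence in \<open>W\<close> along
  which it is unbounded would have no cluster point. By Baire's theorem in the dual some ball of functionals
  is uniformly bounded on \<open>W\<close>, and norming functionals turn this into a bound on norms.
\<close>

lemma relatively_weakly_compact_imp_bounded:
  fixes W :: "'a::real_normed_vector set"
  assumes W: "relatively_weakly_compact W"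
  shows "bounded W"
proof -
  have pointwise: "\<exists>n::nat. \<forall>x\<in>W. \<bar>blinfun_apply g x\<bar> \<le> real n" for g :: "'a \<Rightarrow>\<^sub>L real"
  proof (rule ccontr)
    assume "\<not> ?thesis"
    then have "\<forall>n::nat. \<exists>x\<in>W. real n < \<bar>blinfun_apply g x\<bar>" by (auto simp: not_le)
    then obtain s where s: "\<And>n::nat. s n \<in> W" "\<And>n. real n < \<bar>blinfun_apply g (s n)\<bar>" by metis
    obtain l where "weak_cluster_point sequentially s l"
      using weak_cluster_point_exists[OF W, of sequentially s] s(1) by auto
    then have "\<exists>\<^sub>F n in sequentially. \<bar>blinfun_apply g (s n) - blinfun_apply g l\<bar> < 1"
      by (rule weak_cluster_pointD) simp
    moreover obtain N :: nat where "\<bar>blinfun_apply g l\<bar> + 1 \<le> real N" using real_arch_simple by blast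
    ultimately obtain n where "N \<le> n" "\<bar>blinfun_apply g (s n) - blinfun_apply g l\<bar> < 1"
      unfolding frequently_sequentially by blast
    then show False using s(2)[of n] \<open>\<bar>blinfun_apply g l\<bar> + 1 \<le> real N\<close> by linarith
  qed
  define T where "T n = {g :: 'a \<Rightarrow>\<^sub>L real. \<forall>x\<in>W. \<bar>blinfun_apply g x\<bar> \<le> real n}" for n :: nat
  have closed: "closed (T n)" for n
  proof -
    have "T n = (\<Inter>x\<in>W. {g. \<bar>blinfun_apply g x\<bar> \<le> real n})" by (auto simp: T_def)
    then show ?thesis by (auto intro!: closed_INT closed_Collect_le continuous_intros)
  qed
  have "\<exists>n. interior (T n) \<noteq> {}"
  proof (rule ccontr)
    assume "\<not> ?thesis"
    then have "euclidean interior_of \<Union>(range T) = {}"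
      using closed
      by (intro Baire_category_alt) (auto simp: completely_metrizable_space_euclidean)
    moreover have "\<Union>(range T) = UNIV" using pointwise by (auto simp: T_def)
    ultimately show False by simp
  qed
  then obtain n g0 where "g0 \<in> interior (T n)" by blast
  then obtain r where r: "0 < r" "ball g0 r \<subseteq> T n" by (auto simp: mem_interior)
  have "norm x \<le> 4 * real n / r" if x: "x \<in> W" for x
  proof -
    obtain g :: "'a \<Rightarrow>\<^sub>L real" where g: "norm g \<le> 1" "blinfun_apply g x = norm x"
      by (rule norming_functional)
    have "norm ((r / 2) *\<^sub>R g) < r" using g(1) r(1) by (simp add: mult_less_cancel_left1 field_simps)
    then have "g0 \<in> T n" "g0 + (r / 2) *\<^sub>R g \<in> T n"
      using r by (auto simp: dist_norm intro!: set_mp[OF r(2)])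
    then have "\<bar>blinfun_apply g0 x\<bar> \<le> n" "\<bar>blinfun_apply g0 x + (r / 2) * norm x\<bar> \<le> n"
      using x g(2) by (auto simp: T_def blinfun.add_left blinfun.scaleR_left)
    then have "(r / 2) * norm x \<le> 2 * real n" by linarith
    then show ?thesis using r(1) by (simp add: field_simps)
  qed
  then show ?thesis by (auto simp: bounded_iff)
qed

section \<open>A gliding hump\<close>

text \<open>
  Dependent choice in which the property of the next term refers to the set of all earlier
  terms.
\<close>

lemma history_choice:
  assumes "\<And>k S. finite S \<Longrightarrow> \<exists>y. P k S y"
  shows "\<exists>s :: nat \<Rightarrow> 'b. \<forall>k. P k (s ` {..<k}) (s k)"
proof -
  define H where "H = rec_nat {} (\<lambda>k S. insert (SOME y. P k S y) S)"
  define s where "s k = (SOME y. P k (H k) y)" for k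
  have H: "H k = s ` {..<k}" for k
    by (induction k) (auto simp: H_def s_def lessThan_Suc)
  have "P k (H k) (s k)" for k
    unfolding s_def by (rule someI_ex[OF assms]) (simp add: H)
  then show ?thesis unfolding H by blast
qed

lemma summable_tail_sums_small:
  fixes f :: "nat \<Rightarrow> real"
  assumes "summable f" "\<And>i. 0 \<le> f i" "0 < e"
  obtains N where "\<And>F. finite F \<Longrightarrow> F \<subseteq> {N..} \<Longrightarrow> sum f F \<le> e"
proof -
  obtain N where "\<forall>n\<ge>N. norm (\<Sum>i. f (i + n)) < e"
    using suminf_exist_split[OF assms(3,1)] by blast
  then have "\<bar>\<Sum>i. f (i + N)\<bar> < e" by simp
  then have N: "(\<Sum>i. f (i + N)) \<le> e" by linarith
  have "sum f F \<le> e" if F: "finite F" "F \<subseteq> {N..}" for F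
  proof -
    have "inj_on (\<lambda>i. i - N) F"
    proof (rule inj_onI)
      fix i j assume "i \<in> F" "j \<in> F" "i - N = j - N"
      moreover from this have "N \<le> i" "N \<le> j" using F(2) by auto
      ultimately show "i = j" by linarith
    qed
    then have "(\<Sum>i\<in>(\<lambda>i. i - N) ` F. f (i + N)) = (\<Sum>i\<in>F. f (i - N + N))"
      by (simp add: sum.reindex)
    also have "\<dots> = sum f F"
      using F(2) by (intro sum.cong) auto
    finally have "sum f F = (\<Sum>i\<in>(\<lambda>i. i - N) ` F. f (i + N))" ..
    also have "\<dots> \<le> (\<Sum>i. f (i + N))"
      using assms F by (intro sum_le_suminf) (auto simp: summable_iff_shift)
    finally show ?thesis using N by simp
  qed
  then show thesis using that by blast
qed

lemma summable_abs_if_bounded_sums: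
  fixes q :: "nat \<Rightarrow> real"
  assumes "\<And>F. finite F \<Longrightarrow> (\<Sum>i\<in>F. \<bar>q i\<bar>) \<le> B"
  shows "summable (\<lambda>i. \<bar>q i\<bar>)"
  using assms by (intro bounded_imp_summable[where B = B]) auto

lemma suminf_functional:
  fixes g :: "nat \<Rightarrow> 'a::real_normed_vector \<Rightarrow>\<^sub>L real"
  assumes bd: "\<And>F y. finite F \<Longrightarrow> (\<Sum>i\<in>F. \<bar>blinfun_apply (g i) y\<bar>) \<le> C * norm y"
  shows "\<exists>h :: 'a \<Rightarrow>\<^sub>L real. \<forall>y. (\<lambda>i. blinfun_apply (g i) y) sums blinfun_apply h y"
proof -
  have abs: "summable (\<lambda>i. \<bar>blinfun_apply (g i) y\<bar>)" for y
    using bd by (rule summable_abs_if_bounded_sums)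
  then have summable: "summable (\<lambda>i. blinfun_apply (g i) y)" for y
    by (rule summable_rabs_cancel)
  define h where "h y = (\<Sum>i. blinfun_apply (g i) y)" for y
  have "\<bar>h y\<bar> \<le> norm y * C" for y
  proof -
    have "\<bar>h y\<bar> \<le> (\<Sum>i. \<bar>blinfun_apply (g i) y\<bar>)" unfolding h_def by (rule summable_rabs[OF abs])
    also have "\<dots> \<le> C * norm y" by (rule suminf_le_const[OF abs]) (rule bd, simp)
    finally show ?thesis by (simp add: mult.commute)
  qed
  then have "bounded_linear h"
    using summable by (intro bounded_linear_intro[of h C])
      (auto simp: h_def blinfun.add_right blinfun.scaleR_right suminf_add suminf_mult)
  then show ?thesis
    using summable_sums[OF summable]
    by (intro exI[of _ "Blinfun h"]) (simp add: bounded_linear_Blinfun_apply h_def)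
qed

text \<open>
  The functionals \<open>g i\<close> are the coordinates of a bounded map into \<open>\<ell>\<^sup>1\<close>, and the lemma says that a
  relatively weakly compact set cannot contain vectors with large coordinates arbitrarily far out.
  Otherwise let \<open>l\<close> be a cluster point of \<open>x\<close>. One picks indices \<open>n 0 < n 1 < \<dots>\<close> such that \<open>x (n k) - l\<close> has almost
  all its mass on the selected coordinates in coordinate \<open>n k\<close> alone: the earlier coordinates are small because
  \<open>l\<close> is a cluster point, the later ones because the series converges. The sum \<open>h\<close> of the selected
  coordinates then satisfies \<open>h (x (n k)) \<ge> h l + d / 2\<close> for all \<open>k\<close>. But a cluster point \<open>l'\<close> of the
  subsequence has the same selected coordinates as \<open>l\<close>, so \<open>h l' = h l\<close>, which is impossible.
\<close>

lemma gliding_hump: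
  fixes g :: "nat \<Rightarrow> 'a::real_normed_vector \<Rightarrow>\<^sub>L real" and x :: "nat \<Rightarrow> 'a"
  assumes W: "relatively_weakly_compact W" and x: "\<And>n. x n \<in> W"
    and bd: "\<And>F y. finite F \<Longrightarrow> (\<Sum>i\<in>F. \<bar>blinfun_apply (g i) y\<bar>) \<le> C * norm y"
    and d: "0 < d"
  shows "\<exists>n. blinfun_apply (g n) (x n) < d"
proof (rule ccontr)
  assume "\<not> ?thesis"
  then have big: "d \<le> blinfun_apply (g n) (x n)" for n by (simp add: not_less)
  obtain l where l: "weak_cluster_point sequentially x l"
    using weak_cluster_point_exists[OF W, of sequentially x] x by auto
  have "\<exists>N. \<forall>F. finite F \<longrightarrow> F \<subseteq> {N..} \<longrightarrow> (\<Sum>i\<in>F. \<bar>blinfun_apply (g i) y\<bar>) \<le> d / 8" for y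
  proof -
    have "summable (\<lambda>i. \<bar>blinfun_apply (g i) y\<bar>)"
      using bd by (rule summable_abs_if_bounded_sums)
    then show ?thesis
      using d by (rule_tac summable_tail_sums_small[where e = "d / 8"]) auto
  qed
  then obtain N where N: "\<And>y F. finite F \<Longrightarrow> F \<subseteq> {N y..} \<Longrightarrow>
      (\<Sum>i\<in>F. \<bar>blinfun_apply (g i) y\<bar>) \<le> d / 8"
    by metis
  \<comment> \<open>Three contributions of \<open>d / 8\<close> each will be lost from the hump of height \<open>d\<close>; the bound on the
    earlier coordinates also tends to zero in \<open>k\<close>, which identifies the coordinates of \<open>l'\<close> below.\<close>
  define P where "P k S m \<longleftrightarrow> (\<forall>i\<in>S. i < m \<and> N (x i) \<le> m) \<and> N l \<le> m \<and>
      (\<forall>i\<in>S. \<bar>blinfun_apply (g i) (x m) - blinfun_apply (g i) l\<bar> < d / (8 * (real k + 1)))"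
    for k S m
  have "\<exists>m. P k S m" if S: "finite S" for k S
  proof -
    have ev: "\<forall>\<^sub>F m in sequentially. (\<forall>i\<in>S. i < m \<and> N (x i) \<le> m) \<and> N l \<le> m"
      using S by (auto simp: eventually_conj_iff eventually_ball_finite_distrib
          eventually_gt_at_top eventually_ge_at_top)
    have "\<exists>\<^sub>F m in sequentially. \<forall>h\<in>g ` S.
        \<bar>blinfun_apply h (x m) - blinfun_apply h l\<bar> < d / (8 * (real k + 1))"
      using l[unfolded weak_cluster_point_def, rule_format, of "g ` S" "d / (8 * (real k + 1))"] S d
      by simp
    from eventually_and_frequently_ex[OF ev this] show ?thesis by (auto simp: P_def)
  qed
  from history_choice[of P, OF this] obtain n where n: "P k (n ` {..<k}) (n k)" for k by blast
  have mono: "n j < n k" if "j < k" for j k using n[of k] that by (auto simp: P_def)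
  have tail: "N (x (n j)) \<le> n k" if "j < k" for j k using n[of k] that by (auto simp: P_def)
  have tail_l: "N l \<le> n k" for k using n[of k] by (simp add: P_def)
  have "inj n" using mono by (intro strict_mono_imp_inj_on strict_monoI)
  then have reindex: "sum q (n ` F) = (\<Sum>j\<in>F. q (n j))" for q :: "nat \<Rightarrow> real" and F
    using sum.reindex[of n F q] inj_on_subset[of n UNIV F] by simp
  have old: "\<bar>blinfun_apply (g (n j)) (x (n k)) - blinfun_apply (g (n j)) l\<bar> < d / (8 * (real k + 1))"
    if "j < k" for j k using n[of k] that by (auto simp: P_def)
  have bdn: "(\<Sum>j\<in>F. \<bar>blinfun_apply (g (n j)) y\<bar>) \<le> C * norm y" if "finite F" for F y
    using bd[of "n ` F" y] that unfolding reindex by simp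
  obtain h :: "'a \<Rightarrow>\<^sub>L real" where h: "(\<lambda>j. blinfun_apply (g (n j)) y) sums blinfun_apply h y" for y
    using suminf_functional[of "\<lambda>j. g (n j)" C, OF bdn] by blast
  have hump: "d / 2 \<le> blinfun_apply h (x (n k)) - blinfun_apply h l" for k
  proof -
    let ?a = "\<lambda>j. blinfun_apply (g (n j)) (x (n k)) - blinfun_apply (g (n j)) l"
    have "d / 2 \<le> sum ?a {..<m}" if m: "k < m" for m
    proof -
      have "{..<m} = {..<k} \<union> insert k {k<..<m}" using m by auto
      then have "sum ?a {..<m} = sum ?a ({..<k} \<union> insert k {k<..<m})" by (rule arg_cong)
      also have "\<dots> = sum ?a {..<k} + sum ?a (insert k {k<..<m})"
        by (rule sum.union_disjoint) auto
      also have "sum ?a (insert k {k<..<m}) = ?a k + sum ?a {k<..<m}" by (rule sum.insert) auto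
      finally have split: "sum ?a {..<m} = sum ?a {..<k} + (?a k + sum ?a {k<..<m})" .
      have "\<bar>sum ?a {..<k}\<bar> \<le> (\<Sum>j<k. d / (8 * (real k + 1)))"
        using old by (intro order.trans[OF sum_abs] sum_mono) (simp add: less_imp_le)
      also have "\<dots> \<le> d / 8" using d by (simp add: field_simps)
      finally have 1: "\<bar>sum ?a {..<k}\<bar> \<le> d / 8" .
      have "n ` {k<..<m} \<subseteq> {N (x (n k))..}" using tail by auto
      then have 2: "(\<Sum>j\<in>{k<..<m}. \<bar>blinfun_apply (g (n j)) (x (n k))\<bar>) \<le> d / 8"
        using N[of "n ` {k<..<m}" "x (n k)"] unfolding reindex by simp
      have "n ` insert k {k<..<m} \<subseteq> {N l..}" using tail_l by auto
      then have 3: "\<bar>blinfun_apply (g (n k)) l\<bar> + (\<Sum>j\<in>{k<..<m}. \<bar>blinfun_apply (g (n j)) l\<bar>) \<le> d / 8"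
        using N[of "n ` insert k {k<..<m}" l] unfolding reindex by simp
      have "\<bar>sum ?a {k<..<m}\<bar> \<le> (\<Sum>j\<in>{k<..<m}. \<bar>blinfun_apply (g (n j)) (x (n k))\<bar>)
          + (\<Sum>j\<in>{k<..<m}. \<bar>blinfun_apply (g (n j)) l\<bar>)"
        unfolding sum.distrib[symmetric]
        by (intro order.trans[OF sum_abs] sum_mono) (rule abs_triangle_ineq4)
      then show ?thesis using split 1 2 3 big[of "n k"] d by linarith
    qed
    then have "\<exists>M. \<forall>m\<ge>M. d / 2 \<le> sum ?a {..<m}" by (intro exI[of _ "Suc k"]) simp
    with sums_diff[OF h[of "x (n k)"] h[of l], unfolded sums_def] show ?thesis
      by (rule LIMSEQ_le_const)
  qed
  obtain l' where l': "weak_cluster_point sequentially (\<lambda>k. x (n k)) l'"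
    using weak_cluster_point_exists[OF W, of sequentially "\<lambda>k. x (n k)"] x by auto
  have "blinfun_apply (g (n j)) l' = blinfun_apply (g (n j)) l" for j
  proof (rule weak_cluster_point_eq[OF l'])
    have eq: "d / 8 * inverse (real (Suc k)) = d / (8 * (real k + 1))" for k
      by (simp add: field_simps)
    have "(\<lambda>k. d / 8 * inverse (real (Suc k))) \<longlonglongrightarrow> 0"
      using tendsto_mult[OF tendsto_const[of "d / 8"] LIMSEQ_inverse_real_of_nat] by simp
    then have "(\<lambda>k. d / (8 * (real k + 1))) \<longlonglongrightarrow> 0" unfolding eq .
    moreover have "\<forall>\<^sub>F k in sequentially.
        norm (blinfun_apply (g (n j)) (x (n k)) - blinfun_apply (g (n j)) l) \<le> d / (8 * (real k + 1))"
      using eventually_gt_at_top[of j] by eventually_elim (use old in \<open>simp add: less_imp_le\<close>)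
    ultimately have "(\<lambda>k. blinfun_apply (g (n j)) (x (n k)) - blinfun_apply (g (n j)) l) \<longlonglongrightarrow> 0"
      by (rule Lim_null_comparison[rotated])
    then show "(\<lambda>k. blinfun_apply (g (n j)) (x (n k))) \<longlonglongrightarrow> blinfun_apply (g (n j)) l"
      by (rule LIM_zero_cancel)
  qed
  then have "blinfun_apply h l' = blinfun_apply h l"
    using h[of l'] h[of l] by (simp add: sums_unique2)
  moreover obtain k where "\<bar>blinfun_apply h (x (n k)) - blinfun_apply h l'\<bar> < d / 2"
    using frequently_ex[OF weak_cluster_pointD[OF l', of "d / 2" h]] d by auto
  ultimately show False using hump[of k] by linarith
qed


section \<open>Almost order boundedness of weakly compact sets\<close>

text \<open>
  In an order continuous Banach lattice this is \<open>f (P \<bar>x\<bar>)\<close> with \<open>P\<close> the projection onto the band generated by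
  \<open>v\<close>; the supremum makes sense in every Banach lattice.
\<close>

definition component_functional :: "('a::banach_lattice \<Rightarrow>\<^sub>L real) \<Rightarrow> 'a \<Rightarrow> 'a \<Rightarrow> real" where
  "component_functional f v x = (SUP m\<in>{0..}. blinfun_apply f (inf \<bar>x\<bar> (m *\<^sub>R v)))"

context
  fixes f :: "'a::banach_lattice \<Rightarrow>\<^sub>L real"
  assumes f: "positive_functional f"
begin

lemma component_functional_upper:
  assumes "0 \<le> m"
  shows "blinfun_apply f (inf \<bar>x\<bar> (m *\<^sub>R v)) \<le> component_functional f v x"
  unfolding component_functional_def
proof (rule cSUP_upper)
  show "bdd_above ((\<lambda>m. blinfun_apply f (inf \<bar>x\<bar> (m *\<^sub>R v))) ` {0..})"
    by (rule bdd_aboveI2[where M = "blinfun_apply f \<bar>x\<bar>"])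
      (rule positive_functional_mono[OF f inf_le1])
qed (use assms in simp)

lemma component_functional_least:
  assumes "\<And>m. 0 \<le> m \<Longrightarrow> blinfun_apply f (inf \<bar>x\<bar> (m *\<^sub>R v)) \<le> c"
  shows "component_functional f v x \<le> c"
  unfolding component_functional_def using assms by (intro cSUP_least) auto

lemma component_functional_le: "component_functional f v x \<le> blinfun_apply f \<bar>x\<bar>"
  by (rule component_functional_least) (rule positive_functional_mono[OF f inf_le1])

lemma le_component_functional:
  assumes "v \<le> \<bar>x\<bar>"
  shows "blinfun_apply f v \<le> component_functional f v x"
  using component_functional_upper[of 1 x v] assms by (simp add: inf_absorb2)

lemma component_functional_uminus: "component_functional f v (- x) = component_functional f v x"
  by (simp add: component_functional_def)

lemma sublinear_component_functional:
  assumes v: "0 \<le> v"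
  shows "sublinear (component_functional f v)"
proof (rule sublinearI)
  fix x y
  show "component_functional f v (x + y) \<le> component_functional f v x + component_functional f v y"
  proof (rule component_functional_least)
    fix m :: real assume m: "0 \<le> m"
    have "inf \<bar>x + y\<bar> (m *\<^sub>R v) \<le> inf (\<bar>x\<bar> + \<bar>y\<bar>) (m *\<^sub>R v)"
      by (intro inf_mono abs_triangle_ineq order.refl)
    also have "\<dots> \<le> inf \<bar>x\<bar> (m *\<^sub>R v) + inf \<bar>y\<bar> (m *\<^sub>R v)"
      using v m by (intro inf_add_le scaleR_nonneg_nonneg) auto
    finally show "blinfun_apply f (inf \<bar>x + y\<bar> (m *\<^sub>R v))
        \<le> component_functional f v x + component_functional f v y"
      using positive_functional_mono[OF f] component_functional_upper[OF m, of x v]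
        component_functional_upper[OF m, of y v]
      by (force simp: blinfun.add_right)
  qed
next
  fix c :: real and x :: 'a assume c: "0 < c"
  show "component_functional f v (c *\<^sub>R x) \<le> c * component_functional f v x"
  proof (rule component_functional_least)
    fix m :: real assume m: "0 \<le> m"
    have "inf \<bar>c *\<^sub>R x\<bar> (m *\<^sub>R v) = c *\<^sub>R inf \<bar>x\<bar> ((m / c) *\<^sub>R v)"
      using c by (simp add: abs_scaleR_nonneg scaleR_inf_nonneg)
    then show "blinfun_apply f (inf \<bar>c *\<^sub>R x\<bar> (m *\<^sub>R v)) \<le> c * component_functional f v x"
      using c m component_functional_upper[of "m / c" x v] by (simp add: blinfun.scaleR_right)
  qed
qed

text \<open>
  The truncations \<open>inf \<bar>x\<bar> (m i v i)\<close> that nearly attain the suprema are disjoint minorants of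
  \<open>\<bar>x\<bar>\<close>.
\<close>

lemma sum_component_functional_le:
  assumes fin: "finite F" and v: "\<And>i. i \<in> F \<Longrightarrow> 0 \<le> v i"
    and disj: "\<And>i j. i \<in> F \<Longrightarrow> j \<in> F \<Longrightarrow> i \<noteq> j \<Longrightarrow> inf (v i) (v j) = 0"
  shows "(\<Sum>i\<in>F. component_functional f (v i) x) \<le> blinfun_apply f \<bar>x\<bar>"
proof (rule field_le_epsilon)
  fix e :: real assume e: "0 < e"
  define \<delta> where "\<delta> = e / (real (card F) + 1)"
  have \<delta>: "0 < \<delta>" using e by (simp add: \<delta>_def)
  have "\<exists>m\<ge>0. component_functional f (v i) x \<le> blinfun_apply f (inf \<bar>x\<bar> (m *\<^sub>R v i)) + \<delta>" for i
  proof (rule ccontr)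
    assume no: "\<not> ?thesis"
    have "component_functional f (v i) x \<le> component_functional f (v i) x - \<delta>"
    proof (rule component_functional_least)
      fix m :: real assume "0 \<le> m"
      with no have "\<not> component_functional f (v i) x \<le> blinfun_apply f (inf \<bar>x\<bar> (m *\<^sub>R v i)) + \<delta>"
        by blast
      then show "blinfun_apply f (inf \<bar>x\<bar> (m *\<^sub>R v i)) \<le> component_functional f (v i) x - \<delta>"
        by simp
    qed
    then show False using \<delta> by simp
  qed
  then obtain m where m: "\<And>i. 0 \<le> m i"
      "\<And>i. component_functional f (v i) x \<le> blinfun_apply f (inf \<bar>x\<bar> (m i *\<^sub>R v i)) + \<delta>"
    by metis
  let ?u = "\<lambda>i. inf \<bar>x\<bar> (m i *\<^sub>R v i)"
  have u0: "0 \<le> ?u i" if "i \<in> F" for i using v m that by (simp add: scaleR_nonneg_nonneg)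
  have "sum ?u F \<le> \<bar>x\<bar>"
  proof (rule sum_disjoint_le[OF fin])
    fix i j assume ij: "i \<in> F" "j \<in> F" "i \<noteq> j"
    have "inf (?u i) (?u j) \<le> inf (m i *\<^sub>R v i) (m j *\<^sub>R v j)"
      by (intro inf_mono inf_le2)
    also have "\<dots> = 0" using ij m v disj by (intro inf_scaleR_eq_0) auto
    finally show "inf (?u i) (?u j) = 0"
      using u0 ij by (intro order.antisym) auto
  qed (use u0 in auto)
  then have "(\<Sum>i\<in>F. blinfun_apply f (?u i)) \<le> blinfun_apply f \<bar>x\<bar>"
    using positive_functional_mono[OF f] by (simp flip: blinfun.sum_right)
  moreover have "(\<Sum>i\<in>F. component_functional f (v i) x) \<le> (\<Sum>i\<in>F. blinfun_apply f (?u i) + \<delta>)"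
    by (intro sum_mono m)
  moreover have "(\<Sum>i\<in>F. \<delta>) \<le> e" using e by (simp add: \<delta>_def field_simps)
  ultimately show "(\<Sum>i\<in>F. component_functional f (v i) x) \<le> blinfun_apply f \<bar>x\<bar> + e"
    unfolding sum.distrib by linarith
qed

text \<open>
  Functionals touching the component functionals of \<open>v n\<close> at \<open>x n\<close> satisfy the summability
  condition of the gliding hump by disjointness, and their value at \<open>x n\<close> is at least \<open>f (v n)\<close>.
\<close>

lemma disjoint_minorants_small:
  assumes W: "relatively_weakly_compact W" and x: "\<And>n. x n \<in> W"
    and v: "\<And>n. 0 \<le> v n" "\<And>n. v n \<le> \<bar>x n\<bar>"
    and disj: "\<And>i j :: nat. i \<noteq> j \<Longrightarrow> inf (v i) (v j) = 0"
    and d: "0 < d"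
  shows "\<exists>n. blinfun_apply f (v n) < d"
proof -
  let ?p = "\<lambda>n. component_functional f (v n)"
  have "\<exists>g. (\<forall>y. blinfun_apply g y \<le> ?p n y) \<and> blinfun_apply g (x n) = ?p n (x n)" for n
  proof -
    have "?p n y \<le> norm f * norm y" for y
      using component_functional_le functional_abs_le_norm by (rule order.trans)
    then show ?thesis
      using Hahn_Banach_bounded[OF sublinear_component_functional[OF v(1)], of n "norm f" "x n"]
      by metis
  qed
  then obtain g where g: "\<And>n y. blinfun_apply (g n) y \<le> ?p n y"
      "\<And>n. blinfun_apply (g n) (x n) = ?p n (x n)"
    by metis
  have g_abs: "\<bar>blinfun_apply (g n) y\<bar> \<le> ?p n y" for n y
    using g(1)[of n y] g(1)[of n "- y"]
    by (simp add: component_functional_uminus blinfun.minus_right)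
  have "(\<Sum>i\<in>F. \<bar>blinfun_apply (g i) y\<bar>) \<le> norm f * norm y" if "finite F" for F y
  proof -
    have "(\<Sum>i\<in>F. \<bar>blinfun_apply (g i) y\<bar>) \<le> (\<Sum>i\<in>F. ?p i y)"
      by (intro sum_mono g_abs)
    also have "\<dots> \<le> blinfun_apply f \<bar>y\<bar>"
      using that v(1) disj by (intro sum_component_functional_le)
    also have "\<dots> \<le> norm f * norm y" by (rule functional_abs_le_norm)
    finally show ?thesis .
  qed
  from gliding_hump[where x = x and g = g and C = "norm f", OF W x this d]
  obtain n where "blinfun_apply (g n) (x n) < d" by blast
  then show ?thesis using le_component_functional[OF v(2), of n] g(2)[of n] by (auto intro: exI[of _ n])
qed

text \<open>
  If no \<open>u\<close> works, each \<open>x k \<in> W\<close> can be chosen so that its excess over a large multiple of the earlier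
  \<open>\<bar>x i\<bar>\<close> is not small for \<open>f\<close>. These excesses become disjoint after the further removal of \<open>t y\<close>, where
  \<open>y\<close> dominates a fixed multiple \<open>1 / 2 ^ j\<close> of every later \<open>\<bar>x j\<bar>\<close>; the series for \<open>y\<close> converges because \<open>W\<close> is
  norm bounded. The result contradicts \<open>disjoint_minorants_small\<close>.
\<close>

lemma almost_order_bounded:
  assumes W: "relatively_weakly_compact W" and e: "0 < e"
  shows "\<exists>u\<ge>0. \<forall>x\<in>W. blinfun_apply f (pprt (\<bar>x\<bar> - u)) \<le> e"
proof (rule ccontr)
  assume "\<not> ?thesis"
  then have no: "\<exists>x\<in>W. e < blinfun_apply f (pprt (\<bar>x\<bar> - u))" if "0 \<le> u" for u
    using that by (meson not_le)
  obtain B where B: "0 < B" "\<And>x. x \<in> W \<Longrightarrow> norm x \<le> B"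
    using relatively_weakly_compact_imp_bounded[OF W] by (auto simp: bounded_pos)
  \<comment> \<open>Small enough for \<open>t f y \<le> e / 2\<close>, as \<open>norm y \<le> 2 B\<close>. It is fixed before the vectors \<open>x k\<close>, so that the factor
    \<open>2 ^ k / t\<close> below can compensate the factor \<open>t / 2 ^ k\<close> in the criterion for disjointness.\<close>
  define t where "t = e / (4 * (norm f * B + 1))"
  have fB: "0 \<le> norm f * B" using B(1) by simp
  then have t: "0 < t" using e by (simp add: t_def)
  define P where "P k S x \<longleftrightarrow> x \<in> W \<and>
      e < blinfun_apply f (pprt (\<bar>x\<bar> - (2 ^ k / t) *\<^sub>R (\<Sum>z\<in>S. \<bar>z\<bar>)))" for k :: nat and S x
  have "\<exists>x. P k S x" for k S
  proof -
    have "0 \<le> (2 ^ k / t) *\<^sub>R (\<Sum>z\<in>S. \<bar>z\<bar>)"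
      using t by (intro scaleR_nonneg_nonneg sum_nonneg) auto
    from no[OF this] show ?thesis by (auto simp: P_def)
  qed
  from history_choice[of P, OF this] obtain x where "P k (x ` {..<k}) (x k)" for k by blast
  then have x: "x k \<in> W"
      "e < blinfun_apply f (pprt (\<bar>x k\<bar> - (2 ^ k / t) *\<^sub>R (\<Sum>z\<in>x ` {..<k}. \<bar>z\<bar>)))" for k
    by (simp_all add: P_def)
  define a where "a k = (1 / 2 ^ k :: real) *\<^sub>R \<bar>x k\<bar>" for k
  have a0: "0 \<le> a k" for k by (simp add: a_def scaleR_nonneg_nonneg)
  have norm_a: "norm (a k) \<le> B * (1 / 2) ^ k" for k
    using B(2)[of "x k"] x by (simp add: a_def norm_abs_lattice power_one_over field_simps)
  have geom: "summable (\<lambda>k. B * (1 / 2 :: real) ^ k)"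
    by (intro summable_mult summable_geometric) simp
  have sa: "summable a" by (rule summable_comparison_test[OF _ geom]) (use norm_a in auto)
  define y where "y = suminf a"
  have y0: "0 \<le> y" and a_le: "a k \<le> y" for k
  proof -
    have *: "blinfun_apply g (a k) \<le> blinfun_apply g y" and **: "0 \<le> blinfun_apply g y"
      if g: "positive_functional g" for g and k
    proof -
      have s: "(\<lambda>k. blinfun_apply g (a k)) sums blinfun_apply g y"
        using bounded_linear.sums[OF blinfun.bounded_linear_right summable_sums[OF sa]]
        by (simp add: y_def)
      have nn: "0 \<le> blinfun_apply g (a k)" for k
        using g a0 by (simp add: positive_functional_def)
      show "blinfun_apply g (a k) \<le> blinfun_apply g y"
        using sum_le_suminf[OF sums_summable[OF s], of "{k}"] nn sums_unique[OF s] by simp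
      then show "0 \<le> blinfun_apply g y" using nn order.trans by blast
    qed
    show "0 \<le> y" by (rule le_if_positive_functionals_le) (simp add: **)
    show "a k \<le> y" by (rule le_if_positive_functionals_le) (rule *)
  qed
  have "norm y \<le> (\<Sum>k. B * (1 / 2 :: real) ^ k)"
    unfolding y_def by (rule norm_suminf_le[OF norm_a geom])
  also have "\<dots> = 2 * B" by (simp add: suminf_mult summable_geometric suminf_geometric)
  finally have "blinfun_apply f y \<le> norm f * (2 * B)"
    using norm_blinfun[of f y] mult_left_mono[of "norm y" "2 * B" "norm f"] by simp
  then have "t * blinfun_apply f y \<le> t * (2 * (norm f * B))" using t by simp
  also have "\<dots> \<le> e / 2" using fB e by (simp add: t_def field_simps)
  finally have fy: "t * blinfun_apply f y \<le> e / 2" .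
  define v where "v k = pprt (\<bar>x k\<bar> - (2 ^ k / t) *\<^sub>R (\<Sum>z\<in>x ` {..<k}. \<bar>z\<bar>) - t *\<^sub>R y)" for k
  have v0: "0 \<le> v k" for k by (simp add: v_def)
  have v_le: "v k \<le> \<bar>x k\<bar>" for k
  proof -
    have "0 \<le> (2 ^ k / t) *\<^sub>R (\<Sum>z\<in>x ` {..<k}. \<bar>z\<bar>) + t *\<^sub>R y"
      using t y0 by (intro add_nonneg_nonneg scaleR_nonneg_nonneg sum_nonneg) auto
    then have "\<bar>x k\<bar> - ((2 ^ k / t) *\<^sub>R (\<Sum>z\<in>x ` {..<k}. \<bar>z\<bar>) + t *\<^sub>R y) \<le> \<bar>x k\<bar>"
      by (simp only: diff_le_eq le_add_same_cancel1)
    from pprt_mono[OF this] show ?thesis by (simp add: v_def diff_diff_eq)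
  qed
  have lt_disj: "inf (v i) (v j) = 0" if "i < j" for i j
  proof (rule order.antisym)
    have "v i \<le> pprt (\<bar>x i\<bar> - (t / 2 ^ j) *\<^sub>R \<bar>x j\<bar>)"
    proof -
      have "(t / 2 ^ j) *\<^sub>R \<bar>x j\<bar> = t *\<^sub>R a j" by (simp add: a_def)
      also have "\<dots> \<le> t *\<^sub>R y" using a_le t by (intro scaleR_left_mono) auto
      also have "\<dots> \<le> (2 ^ i / t) *\<^sub>R (\<Sum>z\<in>x ` {..<i}. \<bar>z\<bar>) + t *\<^sub>R y"
        using t by (intro add_increasing order.refl scaleR_nonneg_nonneg sum_nonneg) auto
      finally show ?thesis unfolding v_def diff_diff_eq by (intro pprt_mono diff_mono order.refl)
    qed
    moreover have "v j \<le> pprt (\<bar>x j\<bar> - (2 ^ j / t) *\<^sub>R \<bar>x i\<bar>)"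
    proof -
      have "\<bar>x i\<bar> \<le> (\<Sum>z\<in>x ` {..<j}. \<bar>z\<bar>)"
        using that sum_mono2[of "x ` {..<j}" "{x i}" "\<lambda>z. \<bar>z\<bar>"] by simp
      then have "(2 ^ j / t) *\<^sub>R \<bar>x i\<bar> \<le> (2 ^ j / t) *\<^sub>R (\<Sum>z\<in>x ` {..<j}. \<bar>z\<bar>)"
        using t by (intro scaleR_left_mono) auto
      also have "\<dots> \<le> (2 ^ j / t) *\<^sub>R (\<Sum>z\<in>x ` {..<j}. \<bar>z\<bar>) + t *\<^sub>R y"
        using t y0 by (intro add_increasing2 order.refl scaleR_nonneg_nonneg) auto
      finally show ?thesis unfolding v_def diff_diff_eq by (intro pprt_mono diff_mono order.refl)
    qed
    ultimately have "inf (v i) (v j) \<le>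
        inf (pprt (\<bar>x i\<bar> - (t / 2 ^ j) *\<^sub>R \<bar>x j\<bar>)) (pprt (\<bar>x j\<bar> - (2 ^ j / t) *\<^sub>R \<bar>x i\<bar>))"
      by (rule inf_mono)
    also have "\<dots> = 0" using t by (intro inf_pprt_diff_eq_0) auto
    finally show "inf (v i) (v j) \<le> 0" .
  qed (use v0 in simp)
  have disj: "inf (v i) (v j) = 0" if "i \<noteq> j" for i j
    using lt_disj[of i j] lt_disj[of j i] that by (auto simp: inf_commute neq_iff)
  have big: "e / 2 \<le> blinfun_apply f (v k)" for k
  proof -
    let ?z = "\<bar>x k\<bar> - (2 ^ k / t) *\<^sub>R (\<Sum>z\<in>x ` {..<k}. \<bar>z\<bar>)"
    have "0 \<le> t *\<^sub>R y" using t y0 by (intro scaleR_nonneg_nonneg) auto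
    then have "pprt ?z \<le> v k + t *\<^sub>R y"
      using pprt_add_le[of "?z - t *\<^sub>R y" "t *\<^sub>R y"] by (simp add: v_def)
    then have "blinfun_apply f (pprt ?z) \<le> blinfun_apply f (v k) + t * blinfun_apply f y"
      using positive_functional_mono[OF f] by (fastforce simp: blinfun.add_right blinfun.scaleR_right)
    then show ?thesis using x[of k] fy by linarith
  qed
  obtain k where "blinfun_apply f (v k) < e / 2"
    using disjoint_minorants_small[where x = x and v = v and d = "e / 2", OF W x(1) v0 v_le disj] e
    by auto
  then show False using big[of k] by simp
qed

end

section \<open>Convergence of uo-Cauchy nets\<close>

lemma directed_set_prod:
  assumes "directed_set A r"
  shows "directed_set (A \<times> A) (prod_order r r)"
proof -
  have "A \<noteq> {}" "r \<subseteq> A \<times> A" "refl_on A r" "trans r"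
    and dir: "\<And>a b. a \<in> A \<Longrightarrow> b \<in> A \<Longrightarrow> \<exists>c\<in>A. (a, c) \<in> r \<and> (b, c) \<in> r"
    using assms by (auto simp: directed_set_def preorder_on_def)
  then have "preorder_on (A \<times> A) (prod_order r r)"
    unfolding preorder_on_def refl_on_def trans_def prod_order_def by blast
  moreover have "\<exists>c\<in>A \<times> A. (a, c) \<in> prod_order r r \<and> (b, c) \<in> prod_order r r"
    if "a \<in> A \<times> A" "b \<in> A \<times> A" for a b
    using that dir[of "fst a" "fst b"] dir[of "snd a" "snd b"] by (force simp: prod_order_def)
  ultimately show ?thesis using \<open>A \<noteq> {}\<close> by (auto simp: directed_set_def)
qed

lemma net_filter_neq_bot:
  assumes "directed_set A r"
  shows "net_filter A r \<noteq> bot"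
proof
  assume "net_filter A r = bot"
  then have "eventually (\<lambda>_. False) (net_filter A r)" by simp
  then obtain a where "a \<in> A" "\<forall>b\<in>A. (a, b) \<notin> r" using assms by (auto simp: eventually_net_filter)
  then show False using assms by (auto simp: directed_set_def preorder_on_def refl_on_def)
qed

lemma eventually_net_filter_prod:
  assumes dir: "directed_set A r" and ev: "eventually P (net_filter (A \<times> A) (prod_order r r))"
  shows "\<exists>a\<in>A. \<forall>b\<in>A. \<forall>c\<in>A. (a, b) \<in> r \<longrightarrow> (a, c) \<in> r \<longrightarrow> P (b, c)"
proof -
  obtain a1 a2 where a: "a1 \<in> A" "a2 \<in> A"
      "\<And>b c. b \<in> A \<Longrightarrow> c \<in> A \<Longrightarrow> (a1, b) \<in> r \<Longrightarrow> (a2, c) \<in> r \<Longrightarrow> P (b, c)"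
    using iffD1[OF eventually_net_filter[OF directed_set_prod[OF dir]] ev]
    by (auto simp: prod_order_def)
  obtain a where "a \<in> A" "(a1, a) \<in> r" "(a2, a) \<in> r"
    using dir a unfolding directed_set_def by blast
  moreover have "trans r" using dir by (simp add: directed_set_def preorder_on_def)
  ultimately show ?thesis using a(3) by (intro bexI[of _ a]) (auto dest: transD)
qed

text \<open>
  The centres \<open>c\<close> of the subbasic sets are arbitrary; the triangle inequality reduces them to the
  centre \<open>l\<close>.
\<close>

lemma limitin_abs_weak_topology:
  fixes x :: "'i \<Rightarrow> 'a::banach_lattice"
  assumes lim: "\<And>f :: 'a \<Rightarrow>\<^sub>L real. positive_functional f \<Longrightarrow>
    ((\<lambda>i. blinfun_apply f \<bar>x i - l\<bar>) \<longlongrightarrow> 0) F"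
  shows "limitin abs_weak_topology x l F"
proof -
  let ?B = "{{y. blinfun_apply f \<bar>y - c\<bar> < e} |(f :: 'a \<Rightarrow>\<^sub>L real) c e. positive_functional f \<and> 0 < e}"
  have "\<forall>\<^sub>F i in F. x i \<in> U" if "generate_topology_on ?B U" "l \<in> U" for U
    using that
  proof (induction rule: generate_topology_on.induct)
    case (Int a b)
    then show ?case by (auto simp: eventually_conj_iff)
  next
    case (UN K)
    then obtain k where "k \<in> K" "\<forall>\<^sub>F i in F. x i \<in> k" by blast
    then show ?case by (auto elim: eventually_mono)
  next
    case (Basis s)
    then obtain f :: "'a \<Rightarrow>\<^sub>L real" and c e where s: "s = {y. blinfun_apply f \<bar>y - c\<bar> < e}"
      and f: "positive_functional f" by blast
    define \<delta> where "\<delta> = e - blinfun_apply f \<bar>l - c\<bar>"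
    have "0 < \<delta>" using Basis s by (simp add: \<delta>_def)
    then have "\<forall>\<^sub>F i in F. dist (blinfun_apply f \<bar>x i - l\<bar>) 0 < \<delta>"
      using lim[OF f] by (rule tendstoD[rotated])
    then show ?case
    proof eventually_elim
      case (elim i)
      have "\<bar>x i - c\<bar> \<le> \<bar>x i - l\<bar> + \<bar>l - c\<bar>"
        using abs_triangle_ineq[of "x i - l" "l - c"] by simp
      from positive_functional_mono[OF f this] show ?case
        using elim by (simp add: s \<delta>_def blinfun.add_right)
    qed
  qed simp
  moreover have "l \<in> topspace abs_weak_topology"
  proof -
    have "openin abs_weak_topology {y. blinfun_apply (0 :: 'a \<Rightarrow>\<^sub>L real) \<bar>y - l\<bar> < 1}"
      unfolding abs_weak_topology_def
    proof (rule topology_generated_by_Basis)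
      show "{y. blinfun_apply (0 :: 'a \<Rightarrow>\<^sub>L real) \<bar>y - l\<bar> < 1} \<in> ?B"
        by (rule CollectI, intro exI[of _ "0 :: 'a \<Rightarrow>\<^sub>L real"] exI[of _ l] exI[of _ 1])
          (simp add: positive_functional_def)
    qed
    from openin_subset[OF this] show ?thesis by auto
  qed
  ultimately show ?thesis
    unfolding limitin_def abs_weak_topology_def openin_topology_generated_by_iff by blast
qed

text \<open>
  Split \<open>\<bar>x b - x c\<bar>\<close> at \<open>2 u\<close>. The part below is norm null by order continuity, and the excess is at most
  the sum of the excesses of \<open>\<bar>x b\<bar>\<close> and \<open>\<bar>x c\<bar>\<close> over \<open>u\<close>, which are small for \<open>f\<close> by the choice of
  \<open>u\<close>.
\<close>

lemma uo_Cauchy_imp_abs_weakly_Cauchy: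
  fixes x :: "'i \<Rightarrow> 'a::banach_lattice" and f :: "'a \<Rightarrow>\<^sub>L real"
  assumes oc: "order_continuous TYPE('a)" and dir: "directed_set \<Gamma> r"
    and W: "relatively_weakly_compact (x ` \<Gamma>)" and uo: "uo_Cauchy \<Gamma> r x"
    and f: "positive_functional f" and e: "0 < e"
  shows "\<exists>a\<in>\<Gamma>. \<forall>b\<in>\<Gamma>. \<forall>c\<in>\<Gamma>. (a, b) \<in> r \<longrightarrow> (a, c) \<in> r \<longrightarrow>
    blinfun_apply f \<bar>x b - x c\<bar> \<le> e"
proof -
  obtain u where u: "0 \<le> u" "\<And>z. z \<in> x ` \<Gamma> \<Longrightarrow> blinfun_apply f (pprt (\<bar>z\<bar> - u)) \<le> e / 3"
    using almost_order_bounded[OF f W, of "e / 3"] e by auto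
  let ?d = "\<lambda>(b, c). inf \<bar>x b - x c\<bar> (u + u)"
  have "order_converges (\<Gamma> \<times> \<Gamma>) (prod_order r r) ?d 0"
    using uo u(1) unfolding uo_Cauchy_def uo_converges_def
    by (simp add: case_prod_unfold)
  then have "(?d \<longlongrightarrow> 0) (net_filter (\<Gamma> \<times> \<Gamma>) (prod_order r r))"
    by (rule order_continuousD[OF oc directed_set_prod[OF dir]])
  then have "((\<lambda>p. blinfun_apply f (?d p)) \<longlongrightarrow> blinfun_apply f 0) (net_filter (\<Gamma> \<times> \<Gamma>) (prod_order r r))"
    by (intro tendsto_intros)
  then have "\<forall>\<^sub>F p in net_filter (\<Gamma> \<times> \<Gamma>) (prod_order r r). dist (blinfun_apply f (?d p)) (blinfun_apply f 0) < e / 3"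
    by (rule tendstoD) (use e in simp)
  from eventually_net_filter_prod[OF dir this]
  obtain a where a: "a \<in> \<Gamma>" "\<forall>b\<in>\<Gamma>. \<forall>c\<in>\<Gamma>. (a, b) \<in> r \<longrightarrow> (a, c) \<in> r \<longrightarrow>
      dist (blinfun_apply f (?d (b, c))) (blinfun_apply f 0) < e / 3"
    by blast
  show ?thesis
  proof (intro bexI[OF _ a(1)] ballI impI)
    fix b c assume bc: "b \<in> \<Gamma>" "c \<in> \<Gamma>" "(a, b) \<in> r" "(a, c) \<in> r"
    have "\<bar>x b - x c\<bar> - (u + u) \<le> (\<bar>x b\<bar> - u) + (\<bar>x c\<bar> - u)"
      using abs_triangle_ineq4[of "x b" "x c"] by (simp add: algebra_simps)
    then have "pprt (\<bar>x b - x c\<bar> - (u + u)) \<le> pprt (\<bar>x b\<bar> - u) + pprt (\<bar>x c\<bar> - u)"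
      using pprt_add_le pprt_mono order.trans by blast
    then have "\<bar>x b - x c\<bar> \<le> inf \<bar>x b - x c\<bar> (u + u) + (pprt (\<bar>x b\<bar> - u) + pprt (\<bar>x c\<bar> - u))"
      using eq_inf_add_pprt[of "\<bar>x b - x c\<bar>" "u + u"] add_left_mono by metis
    from positive_functional_mono[OF f this]
    have "blinfun_apply f \<bar>x b - x c\<bar> \<le> blinfun_apply f (?d (b, c)) +
        (blinfun_apply f (pprt (\<bar>x b\<bar> - u)) + blinfun_apply f (pprt (\<bar>x c\<bar> - u)))"
      by (simp add: blinfun.add_right)
    moreover have "\<bar>blinfun_apply f (?d (b, c))\<bar> < e / 3"
      using a(2) bc by (force simp: dist_real_def)
    ultimately show "blinfun_apply f \<bar>x b - x c\<bar> \<le> e"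
      using u(2)[OF imageI[OF bc(1)]] u(2)[OF imageI[OF bc(2)]] by linarith
  qed
qed

text \<open>
  Weak lower semicontinuity of \<open>z \<mapsto> f \<bar>y - z\<bar>\<close>: a functional below \<open>f \<bar>\<cdot>\<bar>\<close> that touches it at \<open>y - l\<close> sees the
  value at \<open>l\<close> as a cluster value.
\<close>

lemma weak_cluster_point_abs_le:
  fixes f :: "'a::banach_lattice \<Rightarrow>\<^sub>L real"
  assumes f: "positive_functional f" and cl: "weak_cluster_point F x l"
    and le: "\<forall>\<^sub>F i in F. blinfun_apply f \<bar>y - x i\<bar> \<le> c"
  shows "blinfun_apply f \<bar>y - l\<bar> \<le> c"
proof (rule field_le_epsilon)
  fix e :: real assume e: "0 < e"
  obtain g :: "'a \<Rightarrow>\<^sub>L real" where g: "\<And>z. blinfun_apply g z \<le> blinfun_apply f \<bar>z\<bar>"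
      "blinfun_apply g (y - l) = blinfun_apply f \<bar>y - l\<bar>"
    using Hahn_Banach_bounded[OF sublinear_functional_abs[OF f] functional_abs_le_norm] by blast
  have "\<exists>\<^sub>F i in F. \<bar>blinfun_apply g (x i) - blinfun_apply g l\<bar> < e"
    using cl e by (rule weak_cluster_pointD)
  from eventually_and_frequently_ex[OF le this]
  obtain i where "blinfun_apply f \<bar>y - x i\<bar> \<le> c"
      "\<bar>blinfun_apply g (x i) - blinfun_apply g l\<bar> < e" by blast
  then show "blinfun_apply f \<bar>y - l\<bar> \<le> c + e"
    using g(1)[of "y - x i"] g(2) by (simp add: blinfun.diff_right)
qed

text \<open>
  A dominating net for the double net \<open>inf \<bar>x a - x c\<bar> y\<close> also dominates \<open>inf \<bar>x a - l\<bar> y\<close>: the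
  truncated modulus changes by at most \<open>\<bar>x c - l\<bar>\<close>, whose image under every positive functional vanishes in
  the limit.
\<close>

lemma uo_Cauchy_abs_weak_limit:
  fixes x :: "'i \<Rightarrow> 'a::banach_lattice"
  assumes dir: "directed_set \<Gamma> r" and uo: "uo_Cauchy \<Gamma> r x"
    and lim: "\<And>f :: 'a \<Rightarrow>\<^sub>L real. positive_functional f \<Longrightarrow>
      ((\<lambda>a. blinfun_apply f \<bar>x a - l\<bar>) \<longlongrightarrow> 0) (net_filter \<Gamma> r)"
  shows "uo_converges \<Gamma> r x l"
  unfolding uo_converges_def
proof (intro allI impI)
  fix y :: 'a assume y: "0 \<le> y"
  have "order_converges (\<Gamma> \<times> \<Gamma>) (prod_order r r) (\<lambda>p. inf \<bar>x (fst p) - x (snd p)\<bar> y) 0"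
    using uo y unfolding uo_Cauchy_def uo_converges_def by (simp add: case_prod_unfold)
  then obtain B :: "'a set" and s z where B: "directed_set B s" "decreases_to_zero B s z"
    and dom: "\<And>b. b \<in> B \<Longrightarrow> \<exists>p\<^sub>0\<in>\<Gamma> \<times> \<Gamma>. \<forall>p\<in>\<Gamma> \<times> \<Gamma>. (p\<^sub>0, p) \<in> prod_order r r \<longrightarrow>
      \<bar>inf \<bar>x (fst p) - x (snd p)\<bar> y - 0\<bar> \<le> z b"
    unfolding order_converges_def by blast
  show "order_converges \<Gamma> r (\<lambda>a. inf \<bar>x a - l\<bar> y) 0"
  proof (rule order_convergesI[OF B])
    fix b assume b: "b \<in> B"
    obtain a0 c0 where ac: "a0 \<in> \<Gamma>" "c0 \<in> \<Gamma>"
      "\<And>a c. a \<in> \<Gamma> \<Longrightarrow> c \<in> \<Gamma> \<Longrightarrow> (a0, a) \<in> r \<Longrightarrow> (c0, c) \<in> r \<Longrightarrow> inf \<bar>x a - x c\<bar> y \<le> z b"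
      using dom[OF b] y by (auto simp: prod_order_def)
    have "inf \<bar>x a - l\<bar> y \<le> z b" if a: "a \<in> \<Gamma>" "(a0, a) \<in> r" for a
    proof (rule le_if_positive_functionals_le)
      fix f :: "'a \<Rightarrow>\<^sub>L real" assume f: "positive_functional f"
      have ev: "\<forall>\<^sub>F c in net_filter \<Gamma> r.
          blinfun_apply f (inf \<bar>x a - l\<bar> y) - blinfun_apply f (z b) \<le> blinfun_apply f \<bar>x c - l\<bar>"
        unfolding eventually_net_filter[OF dir]
      proof (intro bexI[OF _ ac(2)] ballI impI)
        fix c assume c: "c \<in> \<Gamma>" "(c0, c) \<in> r"
        have "inf \<bar>x a - l\<bar> y \<le> inf \<bar>x a - x c\<bar> y + \<bar>\<bar>x a - l\<bar> - \<bar>x a - x c\<bar>\<bar>"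
          by (rule inf_le_inf_plus_abs_diff)
        also have "\<dots> \<le> z b + \<bar>x c - l\<bar>"
          using ac(3)[OF a(1) c(1) a(2) c(2)] abs_triangle_ineq3[of "x a - l" "x a - x c"]
          by (intro add_mono) simp_all
        finally show "blinfun_apply f (inf \<bar>x a - l\<bar> y) - blinfun_apply f (z b)
            \<le> blinfun_apply f \<bar>x c - l\<bar>"
          using positive_functional_mono[OF f] by (fastforce simp: blinfun.add_right)
      qed
      from tendsto_lowerbound[OF lim[OF f] ev net_filter_neq_bot[OF dir]]
      show "blinfun_apply f (inf \<bar>x a - l\<bar> y) \<le> blinfun_apply f (z b)" by simp
    qed
    then show "\<exists>a\<^sub>0\<in>\<Gamma>. \<forall>a\<in>\<Gamma>. (a\<^sub>0, a) \<in> r \<longrightarrow> \<bar>inf \<bar>x a - l\<bar> y - 0\<bar> \<le> z b"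
      using y ac(1) by (intro bexI[of _ a0]) auto
  qed
qed

theorem theorem4p3:
  fixes \<Gamma> :: "'i set" and r :: "'i rel" and x :: "'i \<Rightarrow> 'a::banach_lattice"
  assumes "order_continuous TYPE('a)"
    and "directed_set \<Gamma> r"
    and "relatively_weakly_compact (x ` \<Gamma>)"
    and "uo_Cauchy \<Gamma> r x"
  shows "\<exists>l. uo_converges \<Gamma> r x l \<and>
    limitin abs_weak_topology x l (net_filter \<Gamma> r) \<and>
    (\<forall>f :: 'a \<Rightarrow>\<^sub>L real. positive_functional f \<longrightarrow>
      ((\<lambda>a. blinfun_apply f \<bar>x a - l\<bar>) \<longlongrightarrow> 0) (net_filter \<Gamma> r))"
proof -
  have ev_net: "\<forall>\<^sub>F a in net_filter \<Gamma> r. x a \<in> x ` \<Gamma>"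
    unfolding eventually_net_filter[OF assms(2)] using assms(2) by (auto simp: directed_set_def)
  obtain l where l: "weak_cluster_point (net_filter \<Gamma> r) x l"
    by (rule weak_cluster_point_exists[OF assms(3) net_filter_neq_bot[OF assms(2)] ev_net])
  have lim: "((\<lambda>a. blinfun_apply f \<bar>x a - l\<bar>) \<longlongrightarrow> 0) (net_filter \<Gamma> r)"
    if f: "positive_functional f" for f :: "'a \<Rightarrow>\<^sub>L real"
  proof (rule tendstoI)
    fix e :: real assume e: "0 < e"
    have "0 < e / 2" using e by simp
    from uo_Cauchy_imp_abs_weakly_Cauchy[OF assms f this]
    obtain a where a: "a \<in> \<Gamma>" "\<forall>b\<in>\<Gamma>. \<forall>c\<in>\<Gamma>. (a, b) \<in> r \<longrightarrow> (a, c) \<in> r \<longrightarrow>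
        blinfun_apply f \<bar>x b - x c\<bar> \<le> e / 2"
      by blast
    have "blinfun_apply f \<bar>x b - l\<bar> \<le> e / 2" if b: "b \<in> \<Gamma>" "(a, b) \<in> r" for b
    proof (rule weak_cluster_point_abs_le[OF f l])
      show "\<forall>\<^sub>F c in net_filter \<Gamma> r. blinfun_apply f \<bar>x b - x c\<bar> \<le> e / 2"
        unfolding eventually_net_filter[OF assms(2)] using a b by blast
    qed
    moreover have "0 \<le> blinfun_apply f \<bar>x b - l\<bar>" for b
      using f by (simp add: positive_functional_def)
    ultimately show "\<forall>\<^sub>F b in net_filter \<Gamma> r. dist (blinfun_apply f \<bar>x b - l\<bar>) 0 < e"
      unfolding eventually_net_filter[OF assms(2)] using a(1) e by (intro bexI[of _ a]) force+
  qed
  then show ?thesis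
    using uo_Cauchy_abs_weak_limit[OF assms(2,4)] limitin_abs_weak_topology[of x l "net_filter \<Gamma> r"]
    by blast
qed

end
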